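(* Let $\zeta$ be the Riemann zeta function and let $$h(s)=\frac{1}{s(s+1)}\left(-\frac{\zeta'(s)}{\zeta(s)}-\frac{1}{s-1}\right).$$ For every real $x\ge 1$, $$\frac{\psi_1(x)}{x^2}-\frac12\left(1-\frac1x\right)^2=\frac{1}{2\pi}\int_{-\infty}^{\infty}h(1+it)\,e^{it\log x}\,dt,$$ where the integral $\int_{-\infty}^{\infty}|h(1+it)|\,dt$ converges. Therefore $\psi_1(x)\sim \dfrac{x^2}{2}$ as $x\to\infty$, and hence $\psi(x)\sim x$ as $x\to\infty$.
   Context: The Mangoldt function is $\Lambda(n)=\log p$ if $n=p^m$ with $p$ prime and $m\ge1$ an integer, and $\Lambda(n)=0$ otherwise. $\psi(x)=\sum_{n\le x}\Lambda(n)$ and $\psi_1(x)=\int_1^x\psi(t)\,dt$. $\zeta$ denotes the meromorphic continuation to $\mathbb{C}$ of $\sum_{n\ge1}n^{-s}$ ($\mathrm{Re}(s)>1$). At $s=1$ the function $h$ is understood to be defined by its analytic extension (the singularity there is removable). The notation $f(x)\sim g(x)$ means $\lim_{x\to\infty} f(x)/g(x)=1$. *)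

theory Defs
  imports
    "HOL-Complex_Analysis.Complex_Analysis"
    "HOL-Number_Theory.Prime_Powers"
    "HOL-Library.Landau_Symbols"
begin

text \<open>
  The Mangoldt function is the library's \<^const>\<open>mangoldt\<close>, here at type \<^typ>\<open>nat \<Rightarrow> real\<close>.
\<close>

definition psi :: "real \<Rightarrow> real" where
  "psi x = (\<Sum>n | 1 \<le> n \<and> real n \<le> x. mangoldt n)"

definition psi1 :: "real \<Rightarrow> real" where
  "psi1 x = integral {1..x} psi"

text \<open>
  The meromorphic continuation of the Dirichlet series to the whole plane. The predicate
  \<open>nicely_meromorphic_on\<close> fixes the values on the discrete set left open by
  \<open>meromorphic_on\<close> (no removable singularities, value \<open>0\<close> at poles), which makes the
  continuation unique as a total function. The series is indexed from \<open>0\<close>, hence \<open>Suc n\<close>.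
\<close>

definition zeta :: "complex \<Rightarrow> complex" where
  "zeta = (THE f. f nicely_meromorphic_on UNIV \<and>
                  (\<forall>s. Re s > 1 \<longrightarrow> f s = (\<Sum>n. of_nat (Suc n) powr (- s))))"

definition h_formula :: "complex \<Rightarrow> complex" where
  "h_formula s = 1 / (s * (s + 1)) * (- (deriv zeta s / zeta s) - 1 / (s - 1))"

text \<open>At the removable singularity \<open>s = 1\<close> the value is that of the analytic extension.\<close>

definition h :: "complex \<Rightarrow> complex" where
  "h s = (if s = 1 then Lim (at 1) h_formula else h_formula s)"

end

theory Submission
  imports Defs "HOL-Real_Asymp.Real_Asymp"
begin

text \<open>
  Summing the Taylor expansion of $(n+1)^{1-s} - n^{1-s}$ over $n$ expresses $(s-1)\zeta(s)$ through
  $\zeta(s+1), \zeta(s+2), \dots$ and a remainder series converging further to the left; iterating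
  gives the meromorphic continuation, and the first step gives a holomorphic $g(s) = (s-1)\zeta(s)$
  on Re $s > 0$ with $|g(s)|, |g'(s)| = O((1+|t|)^{1.1})$ near the line Re $s = 1$. The inequality
  $3 + 4\cos\theta + \cos 2\theta \ge 0$ then yields $|g(s)| \ge c(1+|t|)^{0.6}$ for
  $1 \le$ Re $s \le 2$, so that $h = -g'/(s(s+1)g)$ is $O((1+|t|)^{-3/2})$ there.
  For $c > 1$ the kernel $\int e^{sy}/(s(s+1))\,dt = 2\pi\max(0, 1-e^{-y})$ along Re $s = c$, applied to
  the Dirichlet series of $-\zeta'/\zeta$ and to the pole term, gives the formula for
  $\psi_1$ on Re $s = c$; dominated convergence moves it to Re $s = 1$. The Riemann--Lebesgue lemma gives
  $\psi_1(x) \sim x^2/2$, and monotonicity of $\psi$ transfers this to $\psi(x) \sim x$.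
\<close>

section \<open>Meromorphic continuation of the zeta function\<close>

text \<open>Nonvanishing of zeta on Re s = 1 is too weak for the formula: \<open>h\<close> must be
  absolutely integrable there, so the 3-4-1 inequality is used quantitatively. The decimal exponents
  come from one parameter a = 0.1. Interpolating the Taylor remainder makes its sum converge for Re
  s > 1 - a with growth |t|^(1 + a), and Cauchy's inequality on discs of radius 0.05 < a passes this
  growth on to g'. In 3-4-1 the denominators s - 1 contribute |t|^5, so |g|^4 is at least of order
  (Re s - 1)^3 |t|^(4 - a). At distance |t|^(-e) from the line this gives |g| the exponent (4 - a -
  3e)/4, while returning to the line costs 1 + a - e. The two agree for e = 5a = 1/2, with common
  value 1 - 4a = 0.6. Then h has the exponent (1 + a) - 2 - (1 - 4a) = -2 + 5a = -1.5, integrable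
  because a < 0.2. Since \<open>zeta\<close> is a definite description over functions on the whole
  plane, the continuation is carried out everywhere, while the estimates stay in Re s > 0.\<close>

lemma suminf_holomorphic_on:
  fixes f :: "nat \<Rightarrow> complex \<Rightarrow> complex"
  assumes S: "open S" and hol: "\<And>n. f n holomorphic_on S"
    and dom: "\<And>x. x \<in> S \<Longrightarrow>
      \<exists>d>0. \<exists>M. cball x d \<subseteq> S \<and> summable M \<and> (\<forall>n. \<forall>y\<in>cball x d. norm (f n y) \<le> M n)"
  shows "(\<lambda>s. \<Sum>n. f n s) holomorphic_on S"
proof (rule holomorphic_uniform_sequence[OF S])
  show "(\<lambda>s. \<Sum>i<n. f i s) holomorphic_on S" for n
    by (intro holomorphic_intros hol)
  fix x assume "x \<in> S"
  from dom[OF this] obtain d M where d: "d > 0" "cball x d \<subseteq> S" "summable M"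
    "\<And>n y. y \<in> cball x d \<Longrightarrow> norm (f n y) \<le> M n"
    by blast
  then show "\<exists>d>0. cball x d \<subseteq> S \<and> uniform_limit (cball x d) (\<lambda>n s. \<Sum>i<n. f i s) (\<lambda>s. \<Sum>n. f n s) sequentially"
    by (intro exI[of _ d] conjI Weierstrass_m_test) auto
qed

section \<open>Dirichlet series with bounded coefficients\<close>

lemma summable_Suc_powr:
  assumes "a < - 1"
  shows "summable (\<lambda>n. real (Suc n) powr a)"
  using summable_real_powr_iff[of a] assms
    summable_Suc_iff[of "\<lambda>n. real n powr a"] by (simp del: of_nat_Suc)

lemma norm_of_nat_powr: "norm (of_nat n powr s :: complex) = real n powr Re s"
  by (cases "n = 0") (auto simp: norm_powr_real_powr)

definition zeta_series :: "complex \<Rightarrow> complex" where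
  "zeta_series s = (\<Sum>n. of_nat (Suc n) powr (- s))"

lemma zeta_series_sums:
  assumes "Re s > 1"
  shows "(\<lambda>n. of_nat (Suc n) powr (- s)) sums zeta_series s"
proof -
  have "summable (\<lambda>n. norm (of_nat (Suc n) powr (- s) :: complex))"
    using summable_Suc_powr[of "- Re s"] assms unfolding norm_of_nat_powr by simp
  then show ?thesis
    unfolding zeta_series_def by (rule summable_sums[OF summable_norm_cancel])
qed

lemma Re_ge_of_mem_cball: "y \<in> cball x d \<Longrightarrow> Re y \<ge> Re x - d"
proof -
  assume "y \<in> cball x d"
  then have "norm (x - y) \<le> d" by (simp add: dist_norm)
  then show ?thesis using complex_Re_le_cmod[of "x - y"] by simp
qed

lemma cball_subset_halfspace_Re: "b < Re x - d \<Longrightarrow> cball x d \<subseteq> {s. Re s > b}"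
  using Re_ge_of_mem_cball by fastforce

lemma bounded_dirichlet_series_dominated:
  assumes c: "\<And>n. norm (c n) \<le> 1" and x: "Re x > 1"
  shows "\<exists>d>0. \<exists>M. cball x d \<subseteq> {s. Re s > 1} \<and> summable M \<and>
           (\<forall>n. \<forall>y\<in>cball x d. norm (c n * of_nat (Suc n) powr (- y) :: complex) \<le> M n)"
proof -
  \<comment> \<open>Half the distance to the line Re s = 1, so that the exponent
    \<open>Re x - d\<close> of the majorant still exceeds 1.\<close>
  define d where "d = (Re x - 1) / 2"
  have d: "d > 0" "Re x - d > 1" using x by (auto simp: d_def field_simps)
  have "norm (c n * of_nat (Suc n) powr (- y) :: complex) \<le> real (Suc n) powr (- (Re x - d))"
    if "y \<in> cball x d" for n y
  proof -
    have "norm (c n * of_nat (Suc n) powr (- y) :: complex) \<le> 1 * real (Suc n) powr (- Re y)"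
      unfolding norm_mult norm_of_nat_powr using c by (intro mult_mono) auto
    also have "\<dots> \<le> real (Suc n) powr (- (Re x - d))"
      unfolding mult_1 using Re_ge_of_mem_cball[OF that] by (intro powr_mono) auto
    finally show ?thesis .
  qed
  moreover have "summable (\<lambda>n. real (Suc n) powr (- (Re x - d)))"
    using d by (intro summable_Suc_powr) auto
  ultimately show ?thesis
    using d(1) cball_subset_halfspace_Re[OF d(2)] by blast
qed

text \<open>Locally uniform convergence allows termwise differentiation, which brings out the factor
  ln (n + 1). Series with coefficients of logarithmic size, such as \<open>mangoldt\<close>, are
  thereby obtained as derivatives and need no majorant of their own.\<close>

lemma
  fixes c :: "nat \<Rightarrow> complex"
  assumes c: "\<And>n. norm (c n) \<le> 1"
  shows bounded_dirichlet_series_holomorphic: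
      "(\<lambda>s. \<Sum>n. c n * of_nat (Suc n) powr (- s)) holomorphic_on {s. Re s > 1}"
    and bounded_dirichlet_series_deriv: "Re s > 1 \<Longrightarrow>
      (\<lambda>n. - (c n * of_real (ln (real (Suc n))) * of_nat (Suc n) powr (- s))) sums
        deriv (\<lambda>s. \<Sum>n. c n * of_nat (Suc n) powr (- s)) s"
proof -
  show "(\<lambda>s. \<Sum>n. c n * of_nat (Suc n) powr (- s)) holomorphic_on {s. Re s > 1}"
  proof (rule suminf_holomorphic_on)
    show "open {s. Re s > 1}" by (rule open_halfspace_Re_gt)
    show "(\<lambda>s. c n * of_nat (Suc n) powr - s) holomorphic_on {s. 1 < Re s}" for n
      by (intro holomorphic_intros) (auto simp del: of_nat_Suc)
  qed (use bounded_dirichlet_series_dominated[OF c] in simp)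
next
  assume s: "Re s > 1"
  let ?f = "\<lambda>n s. c n * of_nat (Suc n) powr (- s)"
  let ?f' = "\<lambda>n s. - (c n * of_real (ln (real (Suc n))) * of_nat (Suc n) powr (- s))"
  have "\<exists>g'. \<forall>x\<in>{s. Re s > 1}. ((\<lambda>s. \<Sum>n. ?f n s) has_field_derivative g' x) (at x) \<and>
          (\<lambda>n. \<Sum>i<n. ?f' i x) \<longlonglongrightarrow> g' x"
  proof (rule has_complex_derivative_uniform_sequence[where f = "\<lambda>n s. \<Sum>i<n. ?f i s"])
    show "open {s. Re s > 1}" by (rule open_halfspace_Re_gt)
    show "((\<lambda>s. \<Sum>i<n. ?f i s) has_field_derivative (\<Sum>i<n. ?f' i x)) (at x)" for n x
    proof (rule DERIV_sum)
      fix i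
      have eq: "of_nat (Suc i) powr (- s) = exp (- s * of_real (ln (real (Suc i))))" for s :: complex
        using Ln_of_real[of "real (Suc i)"] by (simp add: powr_def del: of_nat_Suc)
      show "(?f i has_field_derivative ?f' i x) (at x)"
        unfolding eq by (auto intro!: derivative_eq_intros simp del: of_nat_Suc)
    qed
    fix x :: complex assume "x \<in> {s. Re s > 1}"
    then have "Re x > 1" by simp
    from bounded_dirichlet_series_dominated[of c, OF c this]
    obtain d M where d: "d > 0" "cball x d \<subseteq> {s. Re s > 1}" "summable M"
      "\<And>n y. y \<in> cball x d \<Longrightarrow> norm (?f n y) \<le> M n"
      by blast
    then show "\<exists>d>0. cball x d \<subseteq> {s. Re s > 1} \<and>
        uniform_limit (cball x d) (\<lambda>n s. \<Sum>i<n. ?f i s) (\<lambda>s. \<Sum>n. ?f n s) sequentially"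
      by (intro exI[of _ d] conjI Weierstrass_m_test) auto
  qed
  then obtain g' where g': "((\<lambda>s. \<Sum>n. ?f n s) has_field_derivative g' s) (at s)"
      "(\<lambda>n. \<Sum>i<n. ?f' i s) \<longlonglongrightarrow> g' s"
    using s by blast
  show "(\<lambda>n. ?f' n s) sums deriv (\<lambda>s. \<Sum>n. ?f n s) s"
    unfolding sums_def DERIV_imp_deriv[OF g'(1)] by (rule g'(2))
qed

lemma zeta_series_holomorphic: "zeta_series holomorphic_on {s. Re s > 1}"
  using bounded_dirichlet_series_holomorphic[of "\<lambda>_. 1"] unfolding zeta_series_def by simp

text \<open>The coefficient (1 - s)(-s)...(2 - s - k) that k differentiations of x^(1 - s)
  produce.\<close>

definition falling_prod :: "nat \<Rightarrow> complex \<Rightarrow> complex" where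
  "falling_prod k s = (\<Prod>j<k. 1 - s - of_nat j)"

lemma falling_prod_holomorphic [holomorphic_intros]: "falling_prod k holomorphic_on A"
  unfolding falling_prod_def by (intro holomorphic_intros)

text \<open>Order-\<open>K\<close> Taylor remainder of $x^{1-s}$ for the step from $n+1$ to $n+2$.\<close>

definition taylor_rem :: "nat \<Rightarrow> nat \<Rightarrow> complex \<Rightarrow> complex" where
  "taylor_rem K n s = of_nat (Suc (Suc n)) powr (1 - s) -
     (\<Sum>k\<le>K. falling_prod k s / fact k * of_nat (Suc n) powr (1 - s - of_nat k))"

lemma taylor_rem_holomorphic: "taylor_rem K n holomorphic_on A"
  unfolding taylor_rem_def by (intro holomorphic_intros) (auto simp del: of_nat_Suc)

text \<open>Taylor's formula on the real segment from n + 1 to n + 2. The derivative of order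
  \<open>Suc K\<close> is largest at the left end, because the hypothesis makes its exponent
  \<open>- Re s - real K\<close> nonpositive; the step length is 1, so no power of it
  remains.\<close>

lemma norm_taylor_rem_le:
  assumes "Re s + real K \<ge> 0"
  shows "norm (taylor_rem K n s) \<le> norm (falling_prod (Suc K) s) * real (Suc n) powr (- Re s - real K) / fact K"
proof -
  define f where "f = (\<lambda>k x. falling_prod k s * x powr (1 - s - of_nat k))"
  define S where "S = closed_segment (of_nat (Suc n) :: complex) (of_nat (Suc (Suc n)))"
  have S: "\<exists>r\<ge>real (Suc n). x = of_real r" if "x \<in> S" for x
  proof -
    have "x \<in> of_real ` closed_segment (real (Suc n)) (real (Suc (Suc n)))"
      using that closed_segment_of_real[of "real (Suc n)" "real (Suc (Suc n))", where 'a = complex]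
      unfolding S_def by simp
    then show ?thesis by (auto simp: closed_segment_eq_real_ivl simp del: of_nat_Suc)
  qed
  have "cmod (f 0 (of_nat (Suc (Suc n))) -
          (\<Sum>i\<le>K. f i (of_nat (Suc n)) * (of_nat (Suc (Suc n)) - of_nat (Suc n)) ^ i / fact i))
        \<le> (norm (falling_prod (Suc K) s) * real (Suc n) powr (- Re s - real K)) *
            cmod (of_nat (Suc (Suc n)) - of_nat (Suc n)) ^ Suc K / fact K"
  proof (rule complex_Taylor[where S = S])
    show "convex S" unfolding S_def by (rule convex_closed_segment)
    show "of_nat (Suc n) \<in> S" "of_nat (Suc (Suc n)) \<in> S" unfolding S_def by auto
  next
    fix i x assume "x \<in> S"
    then obtain r where r: "r \<ge> real (Suc n)" "x = of_real r" using S by blast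
    have "x \<notin> \<real>\<^sub>\<le>\<^sub>0" using r by auto
    then have "(f i has_field_derivative falling_prod i s * ((1 - s - of_nat i) * x powr (1 - s - of_nat i - 1))) (at x)"
      unfolding f_def by (auto intro!: derivative_eq_intros has_field_derivative_powr)
    also have "falling_prod i s * ((1 - s - of_nat i) * x powr (1 - s - of_nat i - 1)) = f (Suc i) x"
      by (simp add: f_def falling_prod_def algebra_simps)
    finally show "(f i has_field_derivative f (Suc i) x) (at x within S)"
      by (rule has_field_derivative_at_within)
  next
    fix x assume "x \<in> S"
    then obtain r where r: "r \<ge> real (Suc n)" "x = of_real r" using S by blast
    have "norm (f (Suc K) x) = norm (falling_prod (Suc K) s) * r powr (- Re s - real K)"
      using r by (simp add: f_def norm_mult norm_powr_real_powr)
    also have "\<dots> \<le> norm (falling_prod (Suc K) s) * real (Suc n) powr (- Re s - real K)"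
      using r assms by (intro mult_left_mono powr_mono2') auto
    finally show "norm (f (Suc K) x) \<le> \<dots>" .
  qed
  moreover have "f 0 (of_nat (Suc (Suc n))) -
          (\<Sum>i\<le>K. f i (of_nat (Suc n)) * (of_nat (Suc (Suc n)) - of_nat (Suc n)) ^ i / fact i) = taylor_rem K n s"
    unfolding taylor_rem_def f_def by (simp add: falling_prod_def)
  ultimately show ?thesis by simp
qed

lemma continuous_on_falling_prod: "continuous_on A (falling_prod k)"
  by (intro holomorphic_on_imp_continuous_on falling_prod_holomorphic)

text \<open>The remainders are O(n^(- Re s - K)) with a factor that is bounded on compact discs, so
  each further Taylor order moves the region of convergence one unit to the left.\<close>

lemma taylor_rem_dominated:
  assumes x: "Re x + real K > 1"
  shows "\<exists>d>0. \<exists>M. cball x d \<subseteq> {s. Re s + real K > 1} \<and> summable M \<and>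
           (\<forall>n. \<forall>y\<in>cball x d. norm (taylor_rem K n y) \<le> M n)"
proof -
  define d where "d = (Re x + real K - 1) / 2"
  have d: "d > 0" "Re x - d + real K > 1" using x by (auto simp: d_def field_simps)
  have "bounded (falling_prod (Suc K) ` cball x d)"
    by (intro compact_imp_bounded compact_continuous_image continuous_on_falling_prod compact_cball)
  then obtain B where B: "\<And>y. y \<in> cball x d \<Longrightarrow> norm (falling_prod (Suc K) y) \<le> B"
    unfolding bounded_iff by blast
  have "norm (taylor_rem K n y) \<le> B * real (Suc n) powr (- (Re x - d) - real K)" if "y \<in> cball x d" for n y
  proof -
    have "norm (taylor_rem K n y) \<le> norm (falling_prod (Suc K) y) * real (Suc n) powr (- Re y - real K) / fact K"
      using Re_ge_of_mem_cball[OF that] d by (intro norm_taylor_rem_le) auto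
    also have "\<dots> \<le> norm (falling_prod (Suc K) y) * real (Suc n) powr (- Re y - real K) / 1"
      by (intro divide_left_mono fact_ge_1 mult_nonneg_nonneg) auto
    also have "\<dots> \<le> B * real (Suc n) powr (- (Re x - d) - real K)"
      unfolding div_by_1 using Re_ge_of_mem_cball[OF that] B[OF that]
      by (intro mult_mono powr_mono order_trans[OF norm_ge_zero B[OF that]]) auto
    finally show ?thesis .
  qed
  moreover have "summable (\<lambda>n. B * real (Suc n) powr (- (Re x - d) - real K))"
    using d by (intro summable_mult summable_Suc_powr) auto
  moreover have "cball x d \<subseteq> {s. Re s + real K > 1}"
    using Re_ge_of_mem_cball d by fastforce
  ultimately show ?thesis using d(1) by blast
qed

lemma suminf_taylor_rem_holomorphic:
  "(\<lambda>s. \<Sum>n. taylor_rem K n s) holomorphic_on {s. Re s + real K > 1}"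
proof (rule suminf_holomorphic_on)
  have "open {s. Re s > 1 - real K}" by (rule open_halfspace_Re_gt)
  also have "{s. Re s > 1 - real K} = {s. Re s + real K > 1}" by auto
  finally show "open {s. Re s + real K > 1}" .
qed (use taylor_rem_dominated taylor_rem_holomorphic in auto)

text \<open>Summed over n, the differences of (n + 1)^(1 - s) telescope to -1. In their Taylor
  expansions the term k = 0 cancels, k = 1 sums to (1 - s) zeta(s) and moves to the left-hand side,
  and k >= 2 involves zeta only at points shifted right by at least 1. For \<open>m = 0\<close> the
  middle sum is empty.\<close>

lemma zeta_series_recurrence:
  assumes s: "Re s > 1"
  shows "(s - 1) * zeta_series s =
    1 + (\<Sum>k=2..Suc m. falling_prod k s / fact k * zeta_series (s + of_nat (k - 1))) + (\<Sum>n. taylor_rem (Suc m) n s)"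
proof -
  define a :: "nat \<Rightarrow> complex" where "a = (\<lambda>n. of_nat (Suc n) powr (1 - s))"
  have "(\<lambda>n. norm (a n)) \<longlonglongrightarrow> 0"
  proof -
    have "(\<lambda>n. real (Suc n) powr (1 - Re s)) \<longlonglongrightarrow> 0"
    proof (rule tendsto_neg_powr)
      show "1 - Re s < 0" using s by simp
      show "LIM n sequentially. real (Suc n) :> at_top"
        by (rule filterlim_compose[OF filterlim_real_sequentially filterlim_Suc])
    qed
    then show ?thesis unfolding a_def norm_of_nat_powr by simp
  qed
  then have "a \<longlonglongrightarrow> 0" by (rule tendsto_norm_zero_cancel)
  from telescope_sums[OF this] have tel: "(\<lambda>n. a (Suc n) - a n) sums (-1)"
    by (simp add: a_def)
  have 1: "(\<lambda>n. \<Sum>k=1..Suc m. falling_prod k s / fact k * of_nat (Suc n) powr (1 - s - of_nat k)) sums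
          (\<Sum>k=1..Suc m. falling_prod k s / fact k * zeta_series (s + of_nat (k - 1)))"
  proof (intro sums_sum sums_mult)
    fix k assume k: "k \<in> {1..Suc m}"
    then have "1 - s - of_nat k = - (s + of_nat (k - 1))" by (auto simp: of_nat_diff)
    moreover have "(\<lambda>n. of_nat (Suc n) powr (- (s + of_nat (k - 1)))) sums zeta_series (s + of_nat (k - 1))"
      by (rule zeta_series_sums) (use s k in auto)
    ultimately show "(\<lambda>n. of_nat (Suc n) powr (1 - s - of_nat k)) sums zeta_series (s + of_nat (k - 1))"
      by (simp only:)
  qed
  have "taylor_rem (Suc m) n s = (a (Suc n) - a n) -
          (\<Sum>k=1..Suc m. falling_prod k s / fact k * of_nat (Suc n) powr (1 - s - of_nat k))" for n
  proof -
    have "{..Suc m} = insert 0 {1..Suc m}" by auto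
    then show ?thesis unfolding taylor_rem_def a_def by (simp add: falling_prod_def del: sum.cl_ivl_Suc)
  qed
  with sums_diff[OF tel 1] have "(\<lambda>n. taylor_rem (Suc m) n s) sums
      (-1 - (\<Sum>k=1..Suc m. falling_prod k s / fact k * zeta_series (s + of_nat (k - 1))))"
    by (simp del: sum.cl_ivl_Suc)
  then have "(\<Sum>n. taylor_rem (Suc m) n s) =
      (-1 - (\<Sum>k=1..Suc m. falling_prod k s / fact k * zeta_series (s + of_nat (k - 1))))"
    by (simp add: sums_iff)
  also have "{1..Suc m} = insert 1 {2..Suc m}" by auto
  also have "(\<Sum>k\<in>insert 1 {2..Suc m}. falling_prod k s / fact k * zeta_series (s + of_nat (k - 1))) =
     (1 - s) * zeta_series s + (\<Sum>k=2..Suc m. falling_prod k s / fact k * zeta_series (s + of_nat (k - 1)))"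
    by (subst sum.insert) (auto simp: falling_prod_def)
  finally show ?thesis by (simp add: algebra_simps)
qed

text \<open>The identity theorem, including the values on the discrete exceptional set: near
  \<open>z\<close> the functions agree off \<open>z\<close>, so they have there either a common
  pole, with value 0, or a common limit, which both take as value.\<close>

lemma nicely_meromorphic_eq_on_connected:
  assumes f: "f nicely_meromorphic_on A" and g: "g nicely_meromorphic_on A"
    and A: "open A" "connected A" and B: "open B" "B \<noteq> {}" "B \<subseteq> A" "\<And>z. z \<in> B \<Longrightarrow> f z = g z"
    and z: "z \<in> A"
  shows "f z = g z"
proof -
  have mero: "f meromorphic_on A" "g meromorphic_on A"
    using f g by (auto simp: nicely_meromorphic_on_def)
  \<comment> \<open>The plain difference need not be nicely meromorphic: at a common pole its value
    is 0, but its limit may be another number. \<open>remove_sings\<close> repairs such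
    values.\<close>
  define d where "d = remove_sings (\<lambda>w. f w - g w)"
  have md: "(\<lambda>w. f w - g w) meromorphic_on A" using mero by (intro meromorphic_intros)
  have ev: "\<forall>\<^sub>F w in at u. d w = f w - g w" if "u \<in> A" for u
    unfolding d_def using md that
    by (intro eventually_remove_sings_eq_at) (meson meromorphic_on_altdef)
  obtain b where b: "b \<in> B" using B by auto
  have "\<forall>\<^sub>F w in at b. w \<in> B" using B b by (intro eventually_at_in_open') auto
  with ev[of b] have "\<forall>\<^sub>F w in at b. d w = 0"
    using B b by (auto elim!: eventually_elim2)
  then have fr: "\<exists>\<^sub>F w in at b. d w = 0"
    by (intro eventually_frequently) auto
  have d0: "d w = 0" if "w \<in> A" for w
  proof (rule frequently_eq_meromorphic_imp_constant[OF fr _ A _ that])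
    show "d nicely_meromorphic_on A" unfolding d_def by (rule remove_sings_nicely_meromorphic[OF md])
    show "b \<in> A" using b B by auto
  qed
  have "\<forall>\<^sub>F w in at z. w \<in> A" using A z by (intro eventually_at_in_open') auto
  with ev[OF z] have eq: "\<forall>\<^sub>F w in at z. f w = g w"
    by eventually_elim (use d0 in auto)
  have "is_pole f z \<longleftrightarrow> is_pole g z" by (rule is_pole_cong[OF eq refl])
  moreover have "f \<midarrow>z\<rightarrow> g z \<longleftrightarrow> g \<midarrow>z\<rightarrow> g z" by (rule tendsto_cong[OF eq])
  moreover have "f \<midarrow>z\<rightarrow> f z \<longleftrightarrow> g \<midarrow>z\<rightarrow> f z" by (rule tendsto_cong[OF eq])
  moreover have "\<not> (is_pole g z \<and> g \<midarrow>z\<rightarrow> c)" for c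
    using not_tendsto_and_filterlim_at_infinity[of "at z" g c] by (auto simp: is_pole_def)
  ultimately show ?thesis using f g z unfolding nicely_meromorphic_on_def
    by (metis (no_types) LIM_unique)
qed


lemma nicely_meromorphic_on_cong_open:
  assumes "open A" "\<And>z. z \<in> A \<Longrightarrow> f z = g z" "f nicely_meromorphic_on A"
  shows "g nicely_meromorphic_on A"
proof -
  have ev: "\<forall>\<^sub>F w in at z. f w = g w" if "z \<in> A" for z
    using eventually_at_in_open'[OF assms(1) that] by eventually_elim (use assms in auto)
  have "f meromorphic_on A \<longleftrightarrow> g meromorphic_on A"
    by (rule meromorphic_on_cong[OF ev refl])
  moreover have "is_pole f z \<longleftrightarrow> is_pole g z" if "z \<in> A" for z
    by (rule is_pole_cong[OF ev[OF that] refl])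
  moreover have "f \<midarrow>z\<rightarrow> c \<longleftrightarrow> g \<midarrow>z\<rightarrow> c" if "z \<in> A" for z c
    by (rule tendsto_cong[OF ev[OF that]])
  ultimately show ?thesis using assms(2,3) unfolding nicely_meromorphic_on_def by simp
qed

lemma nicely_meromorphic_on_UN:
  assumes "\<And>i. i \<in> I \<Longrightarrow> f nicely_meromorphic_on A i"
  shows "f nicely_meromorphic_on (\<Union>i\<in>I. A i)"
  using assms unfolding nicely_meromorphic_on_def by (auto intro: meromorphic_on_UN)

lemma zeta_series_analytic: "zeta_series analytic_on {s. Re s > 1}"
  using zeta_series_holomorphic by (simp add: analytic_on_open open_halfspace_Re_gt)

text \<open>Induction by solving the recurrence for zeta(s): for Re s > -m its right-hand side uses
  zeta only at points with real part above 1 - m, that is, in the previous half-plane.\<close>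

lemma zeta_continuation_halfplane:
  "\<exists>f. f nicely_meromorphic_on {s. Re s > 1 - real m} \<and> (\<forall>s. Re s > 1 \<longrightarrow> f s = zeta_series s)"
proof (induction m)
  case 0
  have "zeta_series nicely_meromorphic_on {s. Re s > 1 - real 0}"
    using analytic_on_imp_nicely_meromorphic_on[OF zeta_series_analytic] by simp
  then show ?case by blast
next
  case (Suc m)
  then obtain f where f: "f nicely_meromorphic_on {s. Re s > 1 - real m}"
    "\<And>s. Re s > 1 \<Longrightarrow> f s = zeta_series s" by blast
  define S where "S = (\<lambda>s. \<Sum>n. taylor_rem (Suc m) n s)"
  define F where "F = (\<lambda>s. (1 + (\<Sum>k=2..Suc m. falling_prod k s / fact k * f (s + of_nat (k - 1))) + S s) / (s - 1))"
  define D where "D = {s. Re s > 1 - real (Suc m)}"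
  have "S holomorphic_on D"
    using suminf_taylor_rem_holomorphic[of "Suc m"] unfolding S_def D_def
    by (rule holomorphic_on_subset) auto
  then have S: "S meromorphic_on D"
    by (intro analytic_on_imp_meromorphic_on) (simp add: D_def analytic_on_open open_halfspace_Re_gt)
  have fk: "(\<lambda>s. f (s + of_nat (k - 1))) meromorphic_on D" if "k \<in> {2..Suc m}" for k
  proof (rule meromorphic_on_compose[of f "{s. Re s > 1 - real m}" "\<lambda>s. s + of_nat (k - 1)"])
    show "f meromorphic_on {s. Re s > 1 - real m}"
      using f(1) by (simp add: nicely_meromorphic_on_def)
    show "(\<lambda>s. s + of_nat (k - 1)) analytic_on D" by (intro analytic_intros)
    show "(\<lambda>s. s + of_nat (k - 1)) ` D \<subseteq> {s. Re s > 1 - real m}"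
      using that by (auto simp: D_def)
  qed
  have "falling_prod k meromorphic_on D" for k
    using falling_prod_holomorphic[of k UNIV]
    by (intro analytic_on_imp_meromorphic_on) (auto simp: analytic_on_holomorphic)
  with fk S have "F meromorphic_on D" unfolding F_def
    by (intro meromorphic_intros)
  \<comment> \<open>The quotient by s - 1 and the shifted copies of \<open>f\<close> leave arbitrary
    values at singular points. \<open>remove_sings\<close> normalises them and keeps the values
    wherever \<open>F\<close> is analytic.\<close>
  then have 1: "remove_sings F nicely_meromorphic_on D" by (rule remove_sings_nicely_meromorphic)
  have Feq: "F s = zeta_series s" if "Re s > 1" for s
  proof -
    have "F s = ((s - 1) * zeta_series s) / (s - 1)"
      unfolding F_def zeta_series_recurrence[OF that, of m] S_def
      using that by (intro arg_cong2[where f = "(/)"] arg_cong2[where f = "(+)"] sum.cong refl) (auto simp: f(2))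
    with that show ?thesis by auto
  qed
  have "remove_sings F s = zeta_series s" if s: "Re s > 1" for s
  proof -
    have "\<forall>\<^sub>F w in nhds s. w \<in> {s. Re s > 1}"
      using s by (intro eventually_nhds_in_open open_halfspace_Re_gt) auto
    then have ev: "\<forall>\<^sub>F w in nhds s. F w = zeta_series w"
      by eventually_elim (use Feq in auto)
    have "zeta_series analytic_on {s}"
      by (rule analytic_on_subset[OF zeta_series_analytic]) (use s in simp)
    with analytic_at_cong[OF ev refl] have "F analytic_on {s}" by simp
    then show ?thesis using Feq[OF s] by simp
  qed
  with 1 show ?case unfolding D_def by blast
qed

lemma connected_halfspace_Re_gt: "connected {s. Re s > b}"
  by (intro convex_connected convex_halfspace_Re_gt)

text \<open>The half-plane continuations agree on overlaps by the identity theorem, so each point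
  may use any half-plane that contains it.\<close>

lemma zeta_continuation:
  "\<exists>f. f nicely_meromorphic_on UNIV \<and> (\<forall>s. Re s > 1 \<longrightarrow> f s = zeta_series s)"
proof -
  obtain f where f: "\<And>m. f m nicely_meromorphic_on {s. Re s > 1 - real m}"
    "\<And>m s. Re s > 1 \<Longrightarrow> f m s = zeta_series s"
    using zeta_continuation_halfplane by metis
  have le: "f m s = f m' s" if "m \<le> m'" "Re s > 1 - real m" for m m' :: nat and s
  proof (rule nicely_meromorphic_eq_on_connected[OF f(1)[of m]])
    show "f m' nicely_meromorphic_on {s. Re s > 1 - real m}"
      using that by (intro nicely_meromorphic_on_subset[OF f(1)]) auto
    show "{s. Re s > 1} \<noteq> {}" by (auto intro!: exI[of _ 2])
  qed (use that f(2) in \<open>auto simp: open_halfspace_Re_gt connected_halfspace_Re_gt\<close>)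
  \<comment> \<open>The summand 1 makes \<open>Re s > 1 - real (N s)\<close> strict, so that
    \<open>s\<close> lies in the open half-plane of index \<open>N s\<close>.\<close>
  define N where "N = (\<lambda>s. nat \<lceil>1 - Re s\<rceil> + 1)"
  define g where "g = (\<lambda>s. f (N s) s)"
  have N: "Re s > 1 - real (N s)" for s
    unfolding N_def by linarith
  have g: "f m s = g s" if "Re s > 1 - real m" for m s
    unfolding g_def by (cases "m \<le> N s") (metis le[of m "N s" s] that, metis le[of "N s" m s] N[of s] nat_le_linear)
  have "g nicely_meromorphic_on (\<Union>m. {s. Re s > 1 - real m})"
    by (intro nicely_meromorphic_on_UN nicely_meromorphic_on_cong_open[OF _ _ f(1)])
       (auto simp: open_halfspace_Re_gt g)
  moreover have "(\<Union>m. {s. Re s > 1 - real m}) = UNIV" using N by blast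
  moreover have "g s = zeta_series s" if "Re s > 1" for s
    using that f(2)[of s] unfolding g_def by simp
  ultimately show ?thesis by auto
qed

text \<open>A definite description has its defining property only once existence and uniqueness are
  known; uniqueness is the identity theorem started from Re s > 1.\<close>

lemma zeta_nicely_meromorphic: "zeta nicely_meromorphic_on UNIV" (is ?A)
  and zeta_eq_series: "Re s > 1 \<Longrightarrow> zeta s = zeta_series s" (is "?C \<Longrightarrow> ?B")
proof -
  let ?P = "\<lambda>f. f nicely_meromorphic_on UNIV \<and>
                  (\<forall>s. Re s > 1 \<longrightarrow> f s = (\<Sum>n. of_nat (Suc n) powr (- s)))"
  obtain f where f: "?P f"
    using zeta_continuation unfolding zeta_series_def by blast
  have "f' = f" if f': "?P f'" for f'
  proof
    fix z show "f' z = f z"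
    proof (rule nicely_meromorphic_eq_on_connected[of f' UNIV f "{s. Re s > 1}"])
      show "{s. Re s > 1} \<noteq> {}" by (auto intro!: exI[of _ 2])
      show "f' z = f z" if "z \<in> {s. Re s > 1}" for z
        using f f' that by (metis mem_Collect_eq)
    qed (use f f' open_halfspace_Re_gt connected_UNIV in \<open>simp_all\<close>)
  qed
  with f have "?P zeta" unfolding zeta_def by (rule theI[where P = ?P])
  then show ?A "?C \<Longrightarrow> ?B" by (auto simp: zeta_series_def)
qed

text \<open>The function g of the overview, as given by the recurrence for \<open>m = 0\<close>.
  Without a division by s - 1 it is holomorphic across s = 1 and can carry all later
  estimates.\<close>

definition zeta_reg :: "complex \<Rightarrow> complex" where
  "zeta_reg s = 1 + (\<Sum>n. taylor_rem 1 n s)"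

lemma zeta_reg_holomorphic: "zeta_reg holomorphic_on {s. Re s > 0}"
  unfolding zeta_reg_def using suminf_taylor_rem_holomorphic[of 1]
  by (intro holomorphic_intros) simp_all

lemma zeta_reg_1 [simp]: "zeta_reg 1 = 1"
proof -
  have "taylor_rem 1 n 1 = 0" for n
    by (simp add: taylor_rem_def falling_prod_def lessThan_Suc del: of_nat_Suc)
  then show ?thesis by (simp add: zeta_reg_def)
qed

lemma zeta_eq_zeta_reg:
  assumes "Re s > 0" "s \<noteq> 1"
  shows "zeta s = zeta_reg s / (s - 1)"
proof -
  define G where "G = (\<lambda>s. zeta_reg s / (s - 1))"
  have hol: "G holomorphic_on {s. Re s > 0} - {1}"
    unfolding G_def by (intro holomorphic_intros holomorphic_on_subset[OF zeta_reg_holomorphic]) auto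
  have op: "open ({s. Re s > 0} - {1})" by (intro open_Diff open_halfspace_Re_gt) auto
  have "zeta s = G s"
  proof (rule nicely_meromorphic_eq_on_connected[of zeta "{s. Re s > 0} - {1}" G "{s. Re s > 1}"])
    show "zeta nicely_meromorphic_on {s. Re s > 0} - {1}"
      using zeta_nicely_meromorphic by (rule nicely_meromorphic_on_subset) auto
    show "G nicely_meromorphic_on {s. Re s > 0} - {1}"
      using hol op by (intro analytic_on_imp_nicely_meromorphic_on) (simp add: analytic_on_open)
    show "connected ({s. Re s > 0} - {1})"
      by (intro connected_open_delete connected_halfspace_Re_gt open_halfspace_Re_gt) auto
    show "{s. Re s > 1} \<noteq> {}" by (auto intro!: exI[of _ 2])
    fix z assume "z \<in> {s. Re s > 1}"
    then have z: "Re z > 1" by simp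
    have "(z - 1) * zeta_series z = zeta_reg z"
      using zeta_series_recurrence[OF z, of 0] by (simp add: zeta_reg_def)
    then have "zeta_series z = G z" using z unfolding G_def by (subst nonzero_eq_divide_eq) (auto simp: mult.commute)
    then show "zeta z = G z" using zeta_eq_series[OF z] by simp
  qed (use assms op in \<open>auto simp: open_halfspace_Re_gt\<close>)
  then show ?thesis by (simp add: G_def)
qed

section \<open>The logarithmic derivative and the 3-4-1 inequality\<close>

text \<open>Absolute summability makes the double family over pairs (d, m) summable. It may then be
  evaluated row by row, giving \<open>U * V\<close>, or grouped by the product n = d m, giving the
  divisor sums.\<close>

lemma has_sum_Dirichlet_product:
  fixes u v :: "nat \<Rightarrow> complex"
  assumes u: "(u has_sum U) {0<..}" "(\<lambda>n. norm (u n)) summable_on {0<..}"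
    and v: "(v has_sum V) {0<..}" "(\<lambda>n. norm (v n)) summable_on {0<..}"
  shows "((\<lambda>n. \<Sum>d | d dvd n. u d * v (n div d)) has_sum (U * V)) {0<..}"
proof -
  let ?P = "{0<..} :: nat set"
  let ?f = "\<lambda>(d, m). u d * v m"
  have "(\<lambda>x. norm (?f x)) summable_on ?P \<times> ?P"
  proof (subst Infinite_Sum.abs_summable_on_Sigma_iff, intro conjI ballI)
    show "(\<lambda>y. norm (?f (x, y))) summable_on ?P" for x
      using summable_on_cmult_right[OF v(2)] by (simp add: norm_mult)
    have "(\<lambda>x. norm (u x) * infsum (\<lambda>y. norm (v y)) ?P) summable_on ?P"
      by (rule summable_on_cmult_left[OF u(2)])
    then show "(\<lambda>x. norm (infsum (\<lambda>y. norm (?f (x, y))) ?P)) summable_on ?P"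
      by (simp add: norm_mult infsum_cmult_right' infsum_nonneg)
  qed
  then have "?f summable_on ?P \<times> ?P" by (rule Infinite_Sum.abs_summable_summable)
  then obtain S where S: "(?f has_sum S) (?P \<times> ?P)" by (auto simp: summable_on_def)
  have "((\<lambda>d. u d * V) has_sum S) ?P"
    by (rule has_sum_SigmaD[OF S]) (use has_sum_cmult_right[OF v(1)] in simp)
  with has_sum_cmult_left[OF u(1)] have "S = U * V" by (metis has_sum_unique)
  moreover have "((\<lambda>(n, d). u d * v (n div d)) has_sum S) (Sigma ?P (\<lambda>n. {d. d dvd n}))"
    using S
    by (subst has_sum_reindex_bij_witness[of _ "\<lambda>(d, m). (d * m, d)" "\<lambda>(n, d). (d, n div d)" "?P \<times> ?P" ?f _ S])
       (auto elim!: dvdE intro!: Nat.gr0I)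
  ultimately have "((\<lambda>(n, d). u d * v (n div d)) has_sum (U * V)) (Sigma ?P (\<lambda>n. {d. d dvd n}))"
    by simp
  then show ?thesis
    by (rule has_sum_SigmaD) (auto intro!: has_sum_finite)
qed

text \<open>At a prime power p^m this is 1/m, the coefficient in the logarithm of the Euler product.
  At n = 1 numerator and denominator both vanish, and the quotient is 0.\<close>

definition log_zeta_coeff :: "nat \<Rightarrow> real" where
  "log_zeta_coeff n = mangoldt n / ln (real n)"

lemma log_zeta_coeff_nonneg: "log_zeta_coeff n \<ge> 0"
  by (cases "n = 0") (auto simp: log_zeta_coeff_def mangoldt_nonneg)

lemma log_zeta_coeff_times_ln: "log_zeta_coeff (Suc n) * ln (real (Suc n)) = mangoldt (Suc n)"
  by (cases "n = 0") (auto simp: log_zeta_coeff_def)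

lemma log_zeta_coeff_le: "log_zeta_coeff (Suc n) \<le> 1"
proof (cases "n = 0")
  case False
  then have "ln (real (Suc n)) > 0" by simp
  moreover have "(mangoldt (Suc n) :: real) \<le> ln (real (Suc n))" by (intro mangoldt_le) auto
  ultimately show ?thesis by (simp add: log_zeta_coeff_def del: of_nat_Suc)
qed (auto simp: log_zeta_coeff_def)

text \<open>A logarithm given by its Dirichlet series requires no choice of branch and no Euler
  product; its relation to zeta is recovered from the derivative.\<close>

definition log_zeta :: "complex \<Rightarrow> complex" where
  "log_zeta s = (\<Sum>n. of_real (log_zeta_coeff (Suc n)) * of_nat (Suc n) powr (- s))"

lemma norm_log_zeta_coeff: "norm (of_real (log_zeta_coeff (Suc n)) :: complex) \<le> 1"
  using log_zeta_coeff_nonneg[of "Suc n"] log_zeta_coeff_le[of n] by simp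

lemma log_zeta_holomorphic: "log_zeta holomorphic_on {s. Re s > 1}"
  unfolding log_zeta_def by (rule bounded_dirichlet_series_holomorphic[OF norm_log_zeta_coeff])

lemma log_zeta_sums:
  assumes "Re s > 1"
  shows "(\<lambda>n. of_real (log_zeta_coeff (Suc n)) * of_nat (Suc n) powr (- s)) sums log_zeta s"
proof -
  obtain d M where d: "d > 0" "summable M"
    "\<forall>n. \<forall>y\<in>cball s d. norm (of_real (log_zeta_coeff (Suc n)) * of_nat (Suc n) powr (- y) :: complex) \<le> M n"
    using bounded_dirichlet_series_dominated[of "\<lambda>n. of_real (log_zeta_coeff (Suc n))", OF norm_log_zeta_coeff assms]
    by (elim exE conjE)
  have "summable (\<lambda>n. of_real (log_zeta_coeff (Suc n)) * of_nat (Suc n) powr (- s) :: complex)"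
    using d(2) by (rule summable_comparison_test') (use d(1,3) in simp)
  then show ?thesis unfolding log_zeta_def by (rule summable_sums)
qed

lemma mangoldt_series_sums:
  assumes "Re s > 1"
  shows "(\<lambda>n. of_real (mangoldt (Suc n)) * of_nat (Suc n) powr (- s)) sums (- deriv log_zeta s)"
proof -
  have "of_real (log_zeta_coeff (Suc n)) * of_real (ln (real (Suc n))) = (of_real (mangoldt (Suc n)) :: complex)" for n
    unfolding of_real_mult[symmetric] log_zeta_coeff_times_ln ..
  then show ?thesis
    using sums_minus[OF bounded_dirichlet_series_deriv[of "\<lambda>n. of_real (log_zeta_coeff (Suc n))", OF norm_log_zeta_coeff assms]]
    unfolding log_zeta_def[abs_def, symmetric] by (simp only: minus_minus)
qed

lemma summable_mangoldt_powr:
  assumes "\<sigma> > 1"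
  shows "summable (\<lambda>n. mangoldt (Suc n) * real (Suc n) powr (- \<sigma>))"
proof -
  have "summable (\<lambda>n. of_real (mangoldt (Suc n)) * of_nat (Suc n) powr (- of_real \<sigma>) :: complex)"
    using mangoldt_series_sums[of "of_real \<sigma>"] assms by (auto simp: sums_iff)
  also have "(\<lambda>n. of_real (mangoldt (Suc n)) * of_nat (Suc n) powr (- of_real \<sigma>) :: complex) =
      (\<lambda>n. of_real (mangoldt (Suc n) * real (Suc n) powr (- \<sigma>)))"
  proof
    fix n
    have "of_real (real (Suc n) powr (- \<sigma>)) = (of_nat (Suc n) powr (- of_real \<sigma>) :: complex)"
      using powr_of_real[of "real (Suc n)" "- \<sigma>"] by simp
    then show "of_real (mangoldt (Suc n)) * of_nat (Suc n) powr (- of_real \<sigma>) =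
        (of_real (mangoldt (Suc n) * real (Suc n) powr (- \<sigma>)) :: complex)" by simp
  qed
  finally show ?thesis by (simp only: summable_of_real_iff)
qed

lemma bij_betw_Suc_UNIV: "bij_betw Suc UNIV {0<..}"
  by (auto simp: bij_betw_def image_def gr0_conv_Suc)

lemma has_sum_pos_nat:
  fixes f :: "nat \<Rightarrow> complex"
  assumes "summable (\<lambda>n. norm (f (Suc n)))" "(\<lambda>n. f (Suc n)) sums S"
  shows "(f has_sum S) {0<..}" "(\<lambda>n. norm (f n)) summable_on {0<..}"
proof -
  have "((\<lambda>n. f (Suc n)) has_sum S) UNIV"
    by (rule norm_summable_imp_has_sum[OF assms])
  then show "(f has_sum S) {0<..}"
    using has_sum_reindex_bij_betw[OF bij_betw_Suc_UNIV, of f S] by simp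
  have "(\<lambda>n. norm (f (Suc n))) summable_on UNIV"
    using assms(1) by (simp add: summable_on_UNIV_nonneg_real_iff)
  then show "(\<lambda>n. norm (f n)) summable_on {0<..}"
    using summable_on_reindex_bij_betw[OF bij_betw_Suc_UNIV, of "\<lambda>n. norm (f n)"] by simp
qed

text \<open>Coefficientwise this is the identity that \<open>mangoldt d\<close> summed over the
  divisors d of n gives ln n, which \<open>mangoldt_sum\<close> supplies, read through the Dirichlet
  product with the constant coefficients of zeta.\<close>

lemma deriv_zeta_series:
  assumes s: "Re s > 1"
  shows "deriv zeta_series s = deriv log_zeta s * zeta_series s"
proof -
  define u where "u = (\<lambda>n. of_real (mangoldt n) * of_nat n powr (- s) :: complex)"
  define v where "v = (\<lambda>n. of_nat n powr (- s) :: complex)"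
  define w where "w = (\<lambda>n. of_real (ln (real n)) * of_nat n powr (- s) :: complex)"
  have "(\<lambda>n. w (Suc n)) sums (- deriv zeta_series s)"
    using sums_minus[OF bounded_dirichlet_series_deriv[of "\<lambda>_. 1" s]] s
    unfolding w_def zeta_series_def[abs_def] by (simp del: of_nat_Suc)
  have u: "(u has_sum (- deriv log_zeta s)) {0<..}" "(\<lambda>n. norm (u n)) summable_on {0<..}"
    using summable_mangoldt_powr[OF s] mangoldt_series_sums[OF s]
    by (intro has_sum_pos_nat; simp add: u_def norm_mult norm_of_nat_powr del: of_nat_Suc of_real_mangoldt)+
  have v: "(v has_sum zeta_series s) {0<..}" "(\<lambda>n. norm (v n)) summable_on {0<..}"
    using summable_Suc_powr[of "- Re s"] s zeta_series_sums[OF s]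
    by (intro has_sum_pos_nat; simp add: v_def norm_of_nat_powr del: of_nat_Suc)+
  have eq: "(\<Sum>d | d dvd n. u d * v (n div d)) = w n" if "n \<in> {0<..}" for n
  proof -
    have "u d * v (n div d) = of_real (mangoldt d) * of_nat n powr (- s)" if "d dvd n" for d
    proof -
      have "of_nat n powr (- s) = (of_real (real d) * of_real (real (n div d))) powr (- s)"
        using that by (simp flip: of_nat_mult)
      also have "\<dots> = of_nat d powr (- s) * of_nat (n div d) powr (- s)"
        by (subst powr_times_real) auto
      finally show ?thesis by (simp add: u_def v_def)
    qed
    then have "(\<Sum>d | d dvd n. u d * v (n div d)) = (\<Sum>d | d dvd n. of_real (mangoldt d) * of_nat n powr (- s))"
      by (intro sum.cong) auto
    also have "\<dots> = of_real (\<Sum>d | d dvd n. mangoldt d) * of_nat n powr (- s)"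
      by (simp add: sum_distrib_right)
    also have "\<dots> = w n"
      using that by (subst mangoldt_sum) (auto simp: w_def)
    finally show ?thesis .
  qed
  have "(w has_sum (- deriv log_zeta s * zeta_series s)) {0<..}"
    using has_sum_Dirichlet_product[OF u v] by (rule has_sum_cong[THEN iffD1, rotated]) (rule eq)
  then have "((\<lambda>n. w (Suc n)) has_sum (- deriv log_zeta s * zeta_series s)) UNIV"
    using has_sum_reindex_bij_betw[OF bij_betw_Suc_UNIV, of w] by simp
  then have "(\<lambda>n. w (Suc n)) sums (- deriv log_zeta s * zeta_series s)"
    by (rule has_sum_imp_sums)
  with \<open>(\<lambda>n. w (Suc n)) sums (- deriv zeta_series s)\<close> have
    "- deriv zeta_series s = - deriv log_zeta s * zeta_series s" by (rule sums_unique2)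
  then show ?thesis by simp
qed

text \<open>By \<open>deriv_zeta_series\<close> the product zeta(s) exp(- log_zeta(s)) has
  derivative 0 on a connected set. The value of the constant is left open; 3-4-1 only uses that it
  is nonzero.\<close>

lemma zeta_series_eq_exp_log_zeta:
  obtains C where "C \<noteq> 0" "\<And>s. Re s > 1 \<Longrightarrow> zeta_series s = C * exp (log_zeta s)"
proof -
  let ?H = "{s. Re s > 1}"
  let ?q = "\<lambda>s. zeta_series s * exp (- log_zeta s)"
  have d: "(?q has_field_derivative 0) (at s)" if "s \<in> ?H" for s
  proof -
    have "(zeta_series has_field_derivative deriv zeta_series s) (at s)"
      "(log_zeta has_field_derivative deriv log_zeta s) (at s)"
      using that by (auto intro!: holomorphic_derivI[OF zeta_series_holomorphic]
          holomorphic_derivI[OF log_zeta_holomorphic] open_halfspace_Re_gt)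
    then have "(?q has_field_derivative
        (deriv zeta_series s * exp (- log_zeta s) + exp (- log_zeta s) * (- deriv log_zeta s) * zeta_series s)) (at s)"
      by (auto intro!: derivative_eq_intros)
    then show ?thesis using deriv_zeta_series[of s] that by simp
  qed
  have "\<exists>C. \<forall>s\<in>?H. ?q s = C"
    by (rule DERIV_zero_connected_constant[of ?H "{}"])
       (use d connected_halfspace_Re_gt open_halfspace_Re_gt in
        \<open>auto intro!: continuous_at_imp_continuous_on DERIV_isCont\<close>)
  then obtain C where C: "\<And>s. Re s > 1 \<Longrightarrow> ?q s = C" by auto
  have eq: "zeta_series s = C * exp (log_zeta s)" if "Re s > 1" for s
    using C[OF that] by (auto simp: exp_minus field_simps)
  \<comment> \<open>At the real point 2 all terms are positive, which rules out C = 0.\<close>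
  have "(\<lambda>n. of_real (real (Suc n) powr (- 2))) sums zeta_series 2"
  proof -
    have "of_real (real (Suc n) powr (- 2)) = (of_nat (Suc n) powr (- 2) :: complex)" for n
      using powr_of_real[of "real (Suc n)" "- 2"] by simp
    then show ?thesis using zeta_series_sums[of 2] by simp
  qed
  then have "(\<lambda>n. real (Suc n) powr (- 2)) sums Re (zeta_series 2)"
    using sums_Re by fastforce
  then have "Re (zeta_series 2) = (\<Sum>n. real (Suc n) powr (- 2))" by (simp add: sums_iff)
  also have "\<dots> > 0"
    by (intro suminf_pos summable_Suc_powr) auto
  finally have "C \<noteq> 0" using eq[of 2] by auto
  with eq show ?thesis using that by blast
qed

lemma three_four_one: "3 + 4 * cos \<theta> + cos (2 * \<theta>) \<ge> (0::real)"
proof -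
  have "3 + 4 * cos \<theta> + cos (2 * \<theta>) = 2 * (1 + cos \<theta>)\<^sup>2"
    using cos_double_cos[of \<theta>] by (simp add: power2_eq_square algebra_simps)
  then show ?thesis by simp
qed

lemma Re_of_nat_powr:
  "Re (of_nat (Suc n) powr (- s)) = real (Suc n) powr (- Re s) * cos (Im s * ln (real (Suc n)))"
proof -
  have "Ln (of_nat (Suc n)) = of_real (ln (real (Suc n)))"
    using Ln_of_real[of "real (Suc n)"] by simp
  then have "of_nat (Suc n) powr (- s) = exp (- s * of_real (ln (real (Suc n))))"
    by (simp add: powr_def del: of_nat_Suc)
  then show ?thesis
    by (simp add: Re_exp powr_def mult.commute del: of_nat_Suc)
qed

text \<open>Termwise: each real part is a nonnegative coefficient times the trigonometric polynomial
  of \<open>three_four_one\<close> at the angle t ln (n + 1).\<close>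

lemma log_zeta_three_four_one:
  assumes "\<sigma> > 1"
  shows "Re (3 * log_zeta (Complex \<sigma> 0) + 4 * log_zeta (Complex \<sigma> t) + log_zeta (Complex \<sigma> (2 * t))) \<ge> 0"
proof -
  have "(\<lambda>n. Re (3 * (of_real (log_zeta_coeff (Suc n)) * of_nat (Suc n) powr (- Complex \<sigma> 0)) +
       4 * (of_real (log_zeta_coeff (Suc n)) * of_nat (Suc n) powr (- Complex \<sigma> t)) +
       of_real (log_zeta_coeff (Suc n)) * of_nat (Suc n) powr (- Complex \<sigma> (2 * t)))) sums
      Re (3 * log_zeta (Complex \<sigma> 0) + 4 * log_zeta (Complex \<sigma> t) + log_zeta (Complex \<sigma> (2 * t)))"
    by (intro sums_Re sums_add sums_mult log_zeta_sums) (use assms in auto)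
  moreover have "Re (3 * (of_real (log_zeta_coeff (Suc n)) * of_nat (Suc n) powr (- Complex \<sigma> 0)) +
       4 * (of_real (log_zeta_coeff (Suc n)) * of_nat (Suc n) powr (- Complex \<sigma> t)) +
       of_real (log_zeta_coeff (Suc n)) * of_nat (Suc n) powr (- Complex \<sigma> (2 * t))) \<ge> 0" (is "?l \<ge> 0") for n
  proof -
    have "?l = log_zeta_coeff (Suc n) * real (Suc n) powr (- \<sigma>) *
        (3 + 4 * cos (t * ln (real (Suc n))) + cos (2 * (t * ln (real (Suc n)))))"
      by (simp add: Re_of_nat_powr algebra_simps del: of_nat_Suc)
    then show ?thesis using three_four_one log_zeta_coeff_nonneg by simp
  qed
  ultimately show ?thesis by (metis (no_types, lifting) sums_le sums_zero)
qed

lemma zeta_three_four_one: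
  obtains c where "c > 0" "\<And>\<sigma> t. \<sigma> > 1 \<Longrightarrow>
    norm (zeta_series (Complex \<sigma> 0)) ^ 3 * norm (zeta_series (Complex \<sigma> t)) ^ 4 *
      norm (zeta_series (Complex \<sigma> (2 * t))) \<ge> c"
proof -
  obtain C where C: "C \<noteq> 0" "\<And>s. Re s > 1 \<Longrightarrow> zeta_series s = C * exp (log_zeta s)"
    using zeta_series_eq_exp_log_zeta by blast
  show ?thesis
  \<comment> \<open>The constant enters 3 + 4 + 1 = 8 times, and the exponential of a nonnegative
    number is at least 1.\<close>
  proof (rule that[of "norm C ^ 8"])
    fix \<sigma> t :: real assume s: "\<sigma> > 1"
    have "norm (zeta_series (Complex \<sigma> 0)) ^ 3 * norm (zeta_series (Complex \<sigma> t)) ^ 4 *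
      norm (zeta_series (Complex \<sigma> (2 * t))) = norm C ^ 8 *
       exp (Re (3 * log_zeta (Complex \<sigma> 0) + 4 * log_zeta (Complex \<sigma> t) + log_zeta (Complex \<sigma> (2 * t))))"
      using s by (simp add: C norm_mult power_mult_distrib exp_add exp_of_nat_mult[symmetric] flip: power_add)
        (simp add: eval_nat_numeral exp_add algebra_simps)
    also have "\<dots> \<ge> norm C ^ 8 * 1"
      using log_zeta_three_four_one[OF s] by (intro mult_left_mono) auto
    finally show "norm C ^ 8 \<le> norm (zeta_series (Complex \<sigma> 0)) ^ 3 * norm (zeta_series (Complex \<sigma> t)) ^ 4 *
      norm (zeta_series (Complex \<sigma> (2 * t)))" by simp
  qed (use C in auto)
qed

section \<open>Bounds near the line Re s = 1\<close>

text \<open>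
  Interpolates between the bounds $|s(s-1)|\,n^{-\sigma-1}$ (second-order Taylor) and
  $2|s-1|\,n^{-\sigma}$ (termwise).
\<close>

lemma norm_taylor_rem_1_le:
  assumes s: "Re s > 0" and a: "0 \<le> a" "a \<le> 1"
  shows "norm (taylor_rem 1 n s) \<le> 2 * norm (s - 1) * norm s powr a * real (Suc n) powr (- Re s - a)"
proof -
  let ?N = "real (Suc n)"
  have s0: "norm s > 0" using s by auto
  have A: "norm (taylor_rem 1 n s) \<le> norm (s - 1) * norm s * ?N powr (- Re s - 1)"
  proof -
    have "falling_prod (Suc 1) s = - s * (1 - s)" by (simp add: falling_prod_def lessThan_Suc)
    then have "norm (falling_prod (Suc 1) s) = norm (s - 1) * norm s"
      by (simp add: norm_mult norm_minus_commute)
    then show ?thesis using norm_taylor_rem_le[of s 1 n] s by simp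
  qed
  have "taylor_rem 1 n s = taylor_rem 0 n s - (1 - s) * of_nat (Suc n) powr (- s)"
    by (simp add: taylor_rem_def falling_prod_def)
  also have "norm \<dots> \<le> norm (taylor_rem 0 n s) + norm ((1 - s) * of_nat (Suc n) powr (- s))"
    by (rule norm_triangle_ineq4)
  also have "\<dots> \<le> norm (s - 1) * ?N powr (- Re s) + norm (s - 1) * ?N powr (- Re s)"
    using norm_taylor_rem_le[of s 0 n] s
    by (intro add_mono) (simp_all add: falling_prod_def norm_mult norm_of_nat_powr norm_minus_commute del: of_nat_Suc)
  finally have B: "norm (taylor_rem 1 n s) \<le> 2 * norm (s - 1) * ?N powr (- Re s)" by simp
  \<comment> \<open>With q = \<open>norm s / ?N\<close>, the bounds \<open>A\<close> and
    \<open>B\<close> are multiples of q^1 and q^0. The power q^a dominates the first when q <= 1 and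
    the second when q >= 1.\<close>
  have eq: "norm s powr a * ?N powr (- Re s - a) = ?N powr (- Re s) * (norm s / ?N) powr a"
    using s0 by (simp add: powr_divide powr_diff del: of_nat_Suc)
  show ?thesis
  proof (cases "norm s \<le> ?N")
    case True
    have "norm s * ?N powr (- Re s - 1) = ?N powr (- Re s) * (norm s / ?N) powr 1"
      using s0 by (simp add: powr_diff del: of_nat_Suc)
    also have "\<dots> \<le> ?N powr (- Re s) * (norm s / ?N) powr a"
      using True a s0 by (intro mult_left_mono powr_mono') (auto simp: divide_simps)
    finally have "norm (s - 1) * (norm s * ?N powr (- Re s - 1)) \<le> norm (s - 1) * (norm s powr a * ?N powr (- Re s - a))"
      unfolding eq by (intro mult_left_mono) auto
    then have "norm (taylor_rem 1 n s) \<le> 1 * (norm (s - 1) * (norm s powr a * ?N powr (- Re s - a)))"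
      using A by (simp add: mult_ac)
    also have "\<dots> \<le> 2 * (norm (s - 1) * (norm s powr a * ?N powr (- Re s - a)))"
      by (intro mult_right_mono) auto
    finally show ?thesis by (simp only: mult.assoc)
  next
    case False
    have "?N powr (- Re s) * 1 \<le> ?N powr (- Re s) * (norm s / ?N) powr a"
      using False a by (intro mult_left_mono ge_one_powr_ge_zero) (auto simp: divide_simps)
    then have "2 * norm (s - 1) * (?N powr (- Re s) * 1) \<le> 2 * norm (s - 1) * (norm s powr a * ?N powr (- Re s - a))"
      unfolding eq by (intro mult_left_mono) auto
    with B show ?thesis by (simp add: mult_ac)
  qed
qed

lemma norm_le_of_Re_bounds:
  assumes "\<bar>Re s\<bar> \<le> b" "1 \<le> b"
  shows "norm s \<le> b * (1 + \<bar>Im s\<bar>)"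
proof -
  have "norm s \<le> \<bar>Re s\<bar> + \<bar>Im s\<bar>" by (rule cmod_le)
  also have "\<dots> \<le> b + b * \<bar>Im s\<bar>" using assms mult_right_mono[of 1 b "\<bar>Im s\<bar>"] by simp
  finally show ?thesis by (simp add: algebra_simps)
qed

text \<open>The interpolated bound with a = 0.1: for Re s >= 0.95 the terms decay at least like
  n^(-1.05), and the price is growth of order 1 + 0.1. The strip is wider than 1 <= Re s <= 2 so as
  to contain discs of radius 0.05 about its points.\<close>

lemma zeta_reg_bound:
  obtains C where "C > 0" "\<And>s. 0.95 \<le> Re s \<Longrightarrow> Re s \<le> 3 \<Longrightarrow> norm (zeta_reg s) \<le> C * (1 + \<bar>Im s\<bar>) powr 1.1"
proof -
  define Z where "Z = (\<Sum>n. real (Suc n) powr (- 1.05))"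
  have sumZ: "summable (\<lambda>n. real (Suc n) powr (- 1.05))" by (intro summable_Suc_powr) auto
  have Z: "Z \<ge> 0" unfolding Z_def by (intro suminf_nonneg sumZ) auto
  show ?thesis
  proof (rule that[of "1 + 12 * Z"])
    fix s assume s: "0.95 \<le> Re s" "Re s \<le> 3"
    let ?B = "1 + \<bar>Im s\<bar>"
    have n1: "norm s \<le> 3 * ?B" "norm (s - 1) \<le> 2 * ?B"
      using s norm_le_of_Re_bounds[of s 3] norm_le_of_Re_bounds[of "s - 1" 2] by auto
    have "norm s powr 0.1 \<le> (3 * ?B) powr 0.1" using n1 by (intro powr_mono2) auto
    also have "\<dots> = 3 powr 0.1 * ?B powr 0.1" by (rule powr_mult)
    also have "\<dots> \<le> 3 powr 1 * ?B powr 0.1" by (intro mult_right_mono powr_mono) auto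
    finally have n2: "norm s powr 0.1 \<le> 3 * ?B powr 0.1" by simp
    have bnd: "norm (taylor_rem 1 n s) \<le> (12 * ?B powr 1.1) * real (Suc n) powr (- 1.05)" for n
    proof -
      have "norm (taylor_rem 1 n s) \<le> 2 * norm (s - 1) * norm s powr 0.1 * real (Suc n) powr (- Re s - 0.1)"
        using s by (intro norm_taylor_rem_1_le) auto
      also have "\<dots> \<le> 2 * (2 * ?B) * (3 * ?B powr 0.1) * real (Suc n) powr (- 1.05)"
        using n1 n2 s by (intro mult_mono powr_mono mult_nonneg_nonneg) auto
      also have "\<dots> = 12 * (?B powr 1 * ?B powr 0.1) * real (Suc n) powr (- 1.05)"
        by simp
      also have "?B powr 1 * ?B powr 0.1 = ?B powr 1.1"
        by (subst powr_add[symmetric]) simp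
      finally show ?thesis .
    qed
    have sm: "summable (\<lambda>n. (12 * ?B powr 1.1) * real (Suc n) powr (- 1.05))"
      by (intro summable_mult sumZ)
    have sn: "summable (\<lambda>n. norm (taylor_rem 1 n s))"
      by (rule summable_comparison_test'[OF sm]) (use bnd in auto)
    have "norm (\<Sum>n. taylor_rem 1 n s) \<le> (\<Sum>n. norm (taylor_rem 1 n s))"
      by (rule summable_norm[OF sn])
    also have "\<dots> \<le> (\<Sum>n. (12 * ?B powr 1.1) * real (Suc n) powr (- 1.05))"
      by (rule suminf_le[OF bnd sn sm])
    also have "\<dots> = 12 * ?B powr 1.1 * Z"
      unfolding Z_def by (rule suminf_mult[OF sumZ])
    finally have "norm (zeta_reg s) \<le> 1 + 12 * ?B powr 1.1 * Z"
      unfolding zeta_reg_def using norm_triangle_ineq[of 1 "\<Sum>n. taylor_rem 1 n s"] by simp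
    also have "\<dots> \<le> ?B powr 1.1 + 12 * ?B powr 1.1 * Z"
      using Z by (intro add_mono mult_right_mono ge_one_powr_ge_zero) auto
    finally show "norm (zeta_reg s) \<le> (1 + 12 * Z) * ?B powr 1.1" by (simp add: algebra_simps)
  qed (use Z in auto)
qed

lemma deriv_zeta_reg_bound:
  obtains C where "C > 0" "\<And>s. 1 \<le> Re s \<Longrightarrow> Re s \<le> 2 \<Longrightarrow> norm (deriv zeta_reg s) \<le> C * (1 + \<bar>Im s\<bar>) powr 1.1"
proof -
  obtain C where C: "C > 0" "\<And>s. 0.95 \<le> Re s \<Longrightarrow> Re s \<le> 3 \<Longrightarrow> norm (zeta_reg s) \<le> C * (1 + \<bar>Im s\<bar>) powr 1.1"
    using zeta_reg_bound by blast
  show ?thesis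
  proof (rule that[of "C * 2 powr 1.1 / 0.05"])
    fix s assume s: "1 \<le> Re s" "Re s \<le> 2"
    \<comment> \<open>The factor 2 absorbs the variation of the imaginary part on the circle: 1 +
      |Im s| + 0.05 <= 2 (1 + |Im s|).\<close>
    have "norm ((deriv ^^ 1) zeta_reg s) \<le> fact 1 * (C * (2 * (1 + \<bar>Im s\<bar>)) powr 1.1) / 0.05 ^ 1"
    proof (rule Cauchy_inequality)
      have sub: "cball s 0.05 \<subseteq> {s. Re s > 0}"
        using s by (intro cball_subset_halfspace_Re) auto
      then show "zeta_reg holomorphic_on ball s 0.05"
        using ball_subset_cball by (blast intro: holomorphic_on_subset[OF zeta_reg_holomorphic])
      show "continuous_on (cball s 0.05) zeta_reg"
        using sub by (intro holomorphic_on_imp_continuous_on holomorphic_on_subset[OF zeta_reg_holomorphic])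
      fix x assume x: "norm (s - x) = 0.05"
      have "\<bar>Re s - Re x\<bar> \<le> 1 / 20" "\<bar>Im s - Im x\<bar> \<le> 1 / 20"
        using abs_Re_le_cmod[of "s - x"] abs_Im_le_cmod[of "s - x"] x by auto
      then have "19 / 20 \<le> Re x" "Re x \<le> 3" "\<bar>Im x\<bar> \<le> \<bar>Im s\<bar> + 1 / 20"
        using s by linarith+
      then have b: "0.95 \<le> Re x" "Re x \<le> 3" "\<bar>Im x\<bar> \<le> \<bar>Im s\<bar> + 0.05"
        by simp_all
      have "norm (zeta_reg x) \<le> C * (1 + \<bar>Im x\<bar>) powr 1.1" using b by (intro C)
      also have "\<dots> \<le> C * (2 * (1 + \<bar>Im s\<bar>)) powr 1.1"
        using b C(1) by (intro mult_left_mono powr_mono2) auto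
      finally show "norm (zeta_reg x) \<le> C * (2 * (1 + \<bar>Im s\<bar>)) powr 1.1" .
    qed auto
    then show "norm (deriv zeta_reg s) \<le> C * 2 powr 1.1 / 0.05 * (1 + \<bar>Im s\<bar>) powr 1.1"
      by (subst (asm) powr_mult) auto
  qed (use C in auto)
qed

lemma zeta_series_eq_zeta_reg: "Re s > 1 \<Longrightarrow> zeta_series s = zeta_reg s / (s - 1)"
  using zeta_eq_series[of s] zeta_eq_zeta_reg[of s] by force

text \<open>3-4-1 solved for its middle factor. The value at \<sigma> is at most C / (\<sigma> - 1),
  whence the cube; the five factors off the real axis each bring a denominator of size at least a
  multiple of 1 + |t|. Against the growth 1.1 of \<open>zeta_reg\<close> at height 2t this leaves
  the exponent 5 - 1.1 = 3.9.\<close>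

lemma zeta_reg_lower_bound_aux:
  assumes t0: "t0 > 0"
  obtains K where "K > 0" "\<And>s. 1 < Re s \<Longrightarrow> Re s \<le> 2 \<Longrightarrow> \<bar>Im s\<bar> \<ge> t0 \<Longrightarrow>
     norm (zeta_reg s) ^ 4 \<ge> K * (Re s - 1) ^ 3 * (1 + \<bar>Im s\<bar>) powr 3.9"
proof -
  obtain C where C: "C > 0" "\<And>s. 0.95 \<le> Re s \<Longrightarrow> Re s \<le> 3 \<Longrightarrow> norm (zeta_reg s) \<le> C * (1 + \<bar>Im s\<bar>) powr 1.1"
    using zeta_reg_bound by blast
  obtain c where c: "c > 0" "\<And>\<sigma> t. \<sigma> > 1 \<Longrightarrow>
    norm (zeta_series (Complex \<sigma> 0)) ^ 3 * norm (zeta_series (Complex \<sigma> t)) ^ 4 *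
      norm (zeta_series (Complex \<sigma> (2 * t))) \<ge> c"
    using zeta_three_four_one by blast
  \<comment> \<open>Since u / (1 + u) increases with u, |t| >= t0 gives |t| >= \<tau> (1 +
    |t|).\<close>
  define \<tau> where "\<tau> = t0 / (1 + t0)"
  have \<tau>: "\<tau> > 0" using t0 by (simp add: \<tau>_def)
  define K where "K = c * \<tau> ^ 5 / (C ^ 4 * 2 powr 1.1)"
  show ?thesis
  proof (rule that[of K])
    show "K > 0" using c(1) \<tau> C(1) by (simp add: K_def)
    fix s assume s: "1 < Re s" "Re s \<le> 2" "\<bar>Im s\<bar> \<ge> t0"
    define \<sigma> t B where "\<sigma> = Re s" and "t = Im s" and "B = 1 + \<bar>t\<bar>"
    have s_eq: "s = Complex \<sigma> t" by (simp add: \<sigma>_def t_def)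
    have B: "B \<ge> 1" by (simp add: B_def)
    have tB: "\<bar>t\<bar> \<ge> \<tau> * B"
      using s(3) t0 by (simp add: \<tau>_def B_def t_def field_simps)
    have \<sigma>: "\<sigma> > 1" "\<sigma> \<le> 2" using s by (auto simp: \<sigma>_def)
    have pos: "\<tau> * B > 0" using \<tau> B by simp
    have n1: "norm (zeta_series (Complex \<sigma> 0)) \<le> C / (\<sigma> - 1)"
    proof -
      have "Complex \<sigma> 0 - 1 = of_real (\<sigma> - 1)" by (simp add: complex_eq_iff)
      then have "norm (Complex \<sigma> 0 - 1) = \<sigma> - 1" using \<sigma> by (simp only: norm_of_real)
      moreover have "norm (zeta_reg (Complex \<sigma> 0)) \<le> C" using C(2)[of "Complex \<sigma> 0"] \<sigma> by simp
      ultimately show ?thesis using \<sigma> by (subst zeta_series_eq_zeta_reg) (auto simp: norm_divide intro!: divide_right_mono)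
    qed
    have n2: "norm (zeta_series (Complex \<sigma> t)) \<le> norm (zeta_reg s) / (\<tau> * B)"
    proof -
      have "norm (Complex \<sigma> t - 1) \<ge> \<tau> * B" using abs_Im_le_cmod[of "Complex \<sigma> t - 1"] tB by simp
      moreover from this pos have "norm (Complex \<sigma> t - 1) > 0" by linarith
      ultimately show ?thesis using \<sigma> pos unfolding s_eq
        by (subst zeta_series_eq_zeta_reg) (auto simp: norm_divide intro!: divide_left_mono mult_pos_pos)
    qed
    have n3: "norm (zeta_series (Complex \<sigma> (2 * t))) \<le> C * 2 powr 1.1 * B powr 1.1 / (\<tau> * B)"
    proof -
      have "norm (Complex \<sigma> (2 * t) - 1) \<ge> \<tau> * B" using abs_Im_le_cmod[of "Complex \<sigma> (2 * t) - 1"] tB by simp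
      moreover have "norm (zeta_reg (Complex \<sigma> (2 * t))) \<le> C * 2 powr 1.1 * B powr 1.1"
      proof -
        have "norm (zeta_reg (Complex \<sigma> (2 * t))) \<le> C * (1 + \<bar>2 * t\<bar>) powr 1.1"
          using C(2)[of "Complex \<sigma> (2 * t)"] \<sigma> by simp
        also have "\<dots> \<le> C * (2 * B) powr 1.1"
          using C(1) by (intro mult_left_mono powr_mono2) (auto simp: B_def)
        also have "\<dots> = C * 2 powr 1.1 * B powr 1.1"
          using B by (simp add: powr_mult)
        finally show ?thesis .
      qed
      ultimately show ?thesis using \<sigma> pos C(1)
        by (subst zeta_series_eq_zeta_reg) (auto simp: norm_divide less_imp_le intro!: frac_le mult_nonneg_nonneg)
    qed
    have "c \<le> norm (zeta_series (Complex \<sigma> 0)) ^ 3 * norm (zeta_series (Complex \<sigma> t)) ^ 4 *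
      norm (zeta_series (Complex \<sigma> (2 * t)))" using c(2)[OF \<sigma>(1)] .
    also have "\<dots> \<le> (C / (\<sigma> - 1)) ^ 3 * (norm (zeta_reg s) / (\<tau> * B)) ^ 4 * (C * 2 powr 1.1 * B powr 1.1 / (\<tau> * B))"
      using n1 n2 n3 pos C(1) \<sigma> by (intro mult_mono power_mono) auto
    also have "\<dots> = C ^ 4 * 2 powr 1.1 / \<tau> ^ 5 * norm (zeta_reg s) ^ 4 / (\<sigma> - 1) ^ 3 * (B powr 1.1 / B ^ 5)"
      using \<tau> B by (simp add: power_divide power_mult_distrib field_simps eval_nat_numeral)
    also have "B powr 1.1 / B ^ 5 = B powr (- 3.9)"
      using B powr_diff[of B "1.1" 5] by simp
    finally have "c * (\<tau> ^ 5 / (C ^ 4 * 2 powr 1.1)) * (\<sigma> - 1) ^ 3 * B powr 3.9 \<le> norm (zeta_reg s) ^ 4"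
      using \<tau> C(1) \<sigma> B by (simp add: powr_minus field_simps)
    then show "norm (zeta_reg s) ^ 4 \<ge> K * (Re s - 1) ^ 3 * (1 + \<bar>Im s\<bar>) powr 3.9"
      by (simp add: K_def \<sigma>_def B_def t_def)
  qed
qed

text \<open>
  For Re $s \ge 1 + \eta(t)$ with $\eta(t) = \alpha^4 (1+|t|)^{-1/2}$ the previous bound suffices. Closer to
  the line, moving horizontally to $1 + \eta(t)$ costs at most half of it by the bound on the
  derivative; $\alpha$ is chosen to make this so.
\<close>

lemma zeta_reg_lower_bound:
  assumes t0: "t0 > 0"
  obtains c where "c > 0" "\<And>s. 1 \<le> Re s \<Longrightarrow> Re s \<le> 2 \<Longrightarrow> \<bar>Im s\<bar> \<ge> t0 \<Longrightarrow>
     norm (zeta_reg s) \<ge> c * (1 + \<bar>Im s\<bar>) powr 0.6"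
proof -
  obtain K where K: "K > 0" "\<And>s. 1 < Re s \<Longrightarrow> Re s \<le> 2 \<Longrightarrow> \<bar>Im s\<bar> \<ge> t0 \<Longrightarrow>
     norm (zeta_reg s) ^ 4 \<ge> K * (Re s - 1) ^ 3 * (1 + \<bar>Im s\<bar>) powr 3.9"
    using zeta_reg_lower_bound_aux[OF t0] by blast
  obtain D where D: "D > 0" "\<And>s. 1 \<le> Re s \<Longrightarrow> Re s \<le> 2 \<Longrightarrow> norm (deriv zeta_reg s) \<le> D * (1 + \<bar>Im s\<bar>) powr 1.1"
    using deriv_zeta_reg_bound by blast
  define \<kappa> where "\<kappa> = root 4 K"
  have \<kappa>: "\<kappa> > 0" "\<kappa> ^ 4 = K" using K(1) by (auto simp: \<kappa>_def)
  \<comment> \<open>The lower bound at distance \<eta> scales like \<eta>^(3/4), thus \<alpha>^3,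
    but the loss on moving scales like \<eta>, thus \<alpha>^4. The spare \<alpha> brings
    \<open>\<alpha> * D\<close> down to at most \<open>\<kappa> / 2\<close>; the minimum with 1
    keeps \<eta> at most 1, so that the shifted point satisfies Re <= 2.\<close>
  define \<alpha> where "\<alpha> = min 1 (\<kappa> / (2 * D))"
  have \<alpha>: "0 < \<alpha>" "\<alpha> \<le> 1" "\<alpha> * D \<le> \<kappa> / 2"
    using \<kappa>(1) D(1) by (auto simp: \<alpha>_def min_def field_simps)
  define \<eta> where "\<eta> = (\<lambda>t. \<alpha> ^ 4 * (1 + \<bar>t\<bar>) powr (- 0.5))" for t :: real
  have \<eta>: "0 < \<eta> t" "\<eta> t \<le> 1" for t
  proof -
    have "1 + \<bar>t\<bar> \<noteq> 0" by linarith
    then show "0 < \<eta> t" using \<alpha> by (simp add: \<eta>_def)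
    have "(1 + \<bar>t\<bar>) powr (- 0.5) \<le> (1 + \<bar>t\<bar>) powr 0" by (intro powr_mono) auto
    moreover have "1 + \<bar>t\<bar> \<noteq> 0" by linarith
    ultimately have "(1 + \<bar>t\<bar>) powr (- 0.5) \<le> 1" by simp
    moreover have "\<alpha> ^ 4 \<le> 1" using \<alpha> by (intro power_le_one) auto
    ultimately show "\<eta> t \<le> 1" unfolding \<eta>_def using \<alpha>(1) by (intro mult_le_one) auto
  qed
  have right: "norm (zeta_reg s) \<ge> \<kappa> * \<alpha> ^ 3 * (1 + \<bar>Im s\<bar>) powr 0.6"
    if s: "1 + \<eta> (Im s) \<le> Re s" "Re s \<le> 2" "\<bar>Im s\<bar> \<ge> t0" for s
  proof -
    let ?B = "1 + \<bar>Im s\<bar>"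
    have "(\<kappa> * \<alpha> ^ 3 * ?B powr 0.6) ^ 4 = K * (\<alpha> ^ 4) ^ 3 * (?B powr 0.6) ^ 4"
      by (simp add: power_mult_distrib \<kappa>(2) flip: power_mult)
    \<comment> \<open>The exponents match: 4 * 0.6 = -3 * 0.5 + 3.9.\<close>
    also have "(?B powr 0.6) ^ 4 = (?B powr (- 0.5)) ^ 3 * ?B powr 3.9"
      by (simp add: powr_power flip: powr_add)
    also have "K * (\<alpha> ^ 4) ^ 3 * ((?B powr (- 0.5)) ^ 3 * ?B powr 3.9) = K * \<eta> (Im s) ^ 3 * ?B powr 3.9"
      by (simp add: \<eta>_def power_mult_distrib)
    also have "\<dots> \<le> K * (Re s - 1) ^ 3 * ?B powr 3.9"
      using s K(1) \<eta>[of "Im s"] by (intro mult_right_mono mult_left_mono power_mono) auto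
    also have "\<dots> \<le> norm (zeta_reg s) ^ 4"
      using s \<eta>[of "Im s"] by (intro K) auto
    \<comment> \<open>The rule compares powers \<open>Suc n\<close>, so \<open>n = 3\<close>
      extracts fourth roots.\<close>
    finally show ?thesis by (rule power_le_imp_le_base[where n = 3, unfolded numeral_eq_Suc, simplified]) simp
  qed
  show ?thesis
  proof (rule that[of "\<kappa> * \<alpha> ^ 3 / 2"])
    show "\<kappa> * \<alpha> ^ 3 / 2 > 0" using \<kappa> \<alpha> by simp
    fix s assume s: "1 \<le> Re s" "Re s \<le> 2" "\<bar>Im s\<bar> \<ge> t0"
    let ?B = "1 + \<bar>Im s\<bar>"
    show "norm (zeta_reg s) \<ge> \<kappa> * \<alpha> ^ 3 / 2 * ?B powr 0.6"
    proof (cases "1 + \<eta> (Im s) \<le> Re s")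
      case True
      have "\<kappa> * \<alpha> ^ 3 / 2 * ?B powr 0.6 \<le> \<kappa> * \<alpha> ^ 3 * ?B powr 0.6"
        using \<kappa> \<alpha> by (intro mult_right_mono) auto
      with right[OF True s(2,3)] show ?thesis by simp
    next
      case False
      define s' where "s' = Complex (1 + \<eta> (Im s)) (Im s)"
      have s': "Im s' = Im s" "Re s' = 1 + \<eta> (Im s)" by (auto simp: s'_def)
      \<comment> \<open>A horizontal segment, written as an intersection of half-planes to make
        convexity immediate.\<close>
      define S where "S = {x. 1 \<le> Re x} \<inter> {x. Re x \<le> 2} \<inter> {x. Im s \<le> Im x} \<inter> {x. Im x \<le> Im s}"
      have S: "x \<in> S \<longleftrightarrow> 1 \<le> Re x \<and> Re x \<le> 2 \<and> Im x = Im s" for x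
        by (auto simp: S_def)
      have "norm (zeta_reg s' - zeta_reg s) \<le> D * ?B powr 1.1 * norm (s' - s)"
      proof (rule field_differentiable_bound[where S = S])
        show "convex S" unfolding S_def
          by (intro convex_Int convex_halfspace_Re_ge convex_halfspace_Re_le convex_halfspace_Im_ge convex_halfspace_Im_le)
        fix z assume z: "z \<in> S"
        have "(zeta_reg has_field_derivative deriv zeta_reg z) (at z)"
          using z by (intro holomorphic_derivI[OF zeta_reg_holomorphic]) (auto simp: S open_halfspace_Re_gt)
        then show "(zeta_reg has_field_derivative deriv zeta_reg z) (at z within S)"
          by (rule has_field_derivative_at_within)
        show "norm (deriv zeta_reg z) \<le> D * ?B powr 1.1"
          using D(2)[of z] z by (simp add: S)
      qed (use s s' \<eta>[of "Im s"] in \<open>auto simp: S\<close>)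
      also have "norm (s' - s) \<le> \<eta> (Im s)"
      proof -
        have "s' - s = of_real (1 + \<eta> (Im s) - Re s)" by (simp add: complex_eq_iff s')
        then have "norm (s' - s) = \<bar>1 + \<eta> (Im s) - Re s\<bar>" by (simp only: norm_of_real)
        with False s show ?thesis by linarith
      qed
      then have "D * ?B powr 1.1 * norm (s' - s) \<le> D * ?B powr 1.1 * \<eta> (Im s)"
        using D(1) by (intro mult_left_mono) auto
      also have "D * ?B powr 1.1 * \<eta> (Im s) = (\<alpha> * D) * \<alpha> ^ 3 * (?B powr 1.1 * ?B powr (- 0.5))"
        by (simp add: \<eta>_def power3_eq_cube power4_eq_xxxx)
      also have "?B powr 1.1 * ?B powr (- 0.5) = ?B powr 0.6" by (simp flip: powr_add)
      also have "(\<alpha> * D) * \<alpha> ^ 3 * ?B powr 0.6 \<le> \<kappa> / 2 * \<alpha> ^ 3 * ?B powr 0.6"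
        using \<alpha> by (intro mult_right_mono) auto
      finally have "norm (zeta_reg s' - zeta_reg s) \<le> \<kappa> * \<alpha> ^ 3 / 2 * ?B powr 0.6" by simp
      moreover have "norm (zeta_reg s') \<ge> \<kappa> * \<alpha> ^ 3 * ?B powr 0.6"
        using right[of s'] s s' \<eta>[of "Im s"] by simp
      moreover have "norm (zeta_reg s') \<le> norm (zeta_reg s) + norm (zeta_reg s' - zeta_reg s)"
        by (metis add.commute diff_add_cancel norm_triangle_ineq)
      ultimately show ?thesis by simp
    qed
  qed
qed

text \<open>Three regions, three reasons: the exponential formula for Re s > 1, the value 1 at s =
  1, and on the rest of the line the lower bound taken with t0 = |Im s|.\<close>

lemma zeta_reg_nonzero:
  assumes "Re s \<ge> 1"
  shows "zeta_reg s \<noteq> 0"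
proof -
  consider "Re s > 1" | "s = 1" | "Re s = 1" "Im s \<noteq> 0"
    using assms by (metis complex_eqI less_le one_complex.sel)
  then show ?thesis
  proof cases
    case 1
    obtain C where "C \<noteq> 0" "zeta_series s = C * exp (log_zeta s)"
      using zeta_series_eq_exp_log_zeta 1 by metis
    then have "zeta_series s \<noteq> 0" by simp
    then show ?thesis using zeta_series_eq_zeta_reg[OF 1] by auto
  next
    case 3
    then obtain c where "c > 0" "norm (zeta_reg s) \<ge> c * (1 + \<bar>Im s\<bar>) powr 0.6"
      using zeta_reg_lower_bound[of "\<bar>Im s\<bar>"] by (metis order_refl zero_less_abs_iff assms one_le_numeral)
    moreover have "1 + \<bar>Im s\<bar> \<noteq> 0" by linarith
    then have "(1 + \<bar>Im s\<bar>) powr 0.6 > 0" by simp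
    with \<open>c > 0\<close> have "c * (1 + \<bar>Im s\<bar>) powr 0.6 > 0" by (rule mult_pos_pos)
    ultimately have "norm (zeta_reg s) > 0" by linarith
    then show ?thesis by simp
  qed auto
qed

section \<open>The function h without its singularity\<close>

definition h_reg :: "complex \<Rightarrow> complex" where
  "h_reg s = - (deriv zeta_reg s / (s * (s + 1) * zeta_reg s))"

lemma h_reg_continuous: "continuous_on {s. Re s \<ge> 1} h_reg"
proof -
  have "zeta_reg holomorphic_on {s. Re s > 0}" by (rule zeta_reg_holomorphic)
  moreover from this have "deriv zeta_reg holomorphic_on {s. Re s > 0}"
    by (rule holomorphic_deriv[OF _ open_halfspace_Re_gt])
  ultimately have "continuous_on {s. Re s \<ge> 1} zeta_reg" "continuous_on {s. Re s \<ge> 1} (deriv zeta_reg)"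
    by (auto intro!: holomorphic_on_imp_continuous_on elim!: holomorphic_on_subset)
  moreover have "s \<noteq> 0" "s + 1 \<noteq> 0" if "Re s \<ge> 1" for s
    using that by (auto simp: complex_eq_iff)
  ultimately show ?thesis unfolding h_reg_def
    using zeta_reg_nonzero by (intro continuous_intros) auto
qed

text \<open>With g = \<open>zeta_reg\<close>, the quotient g / (s - 1) has logarithmic derivative
  g'/g - 1/(s - 1), whose polar term cancels the one subtracted in \<open>h_formula\<close>.\<close>

lemma h_formula_eq_h_reg:
  assumes "Re s > 0" "s \<noteq> 1" "zeta_reg s \<noteq> 0"
  shows "h_formula s = h_reg s"
proof -
  have ev: "\<forall>\<^sub>F w in nhds s. zeta w = zeta_reg w / (w - 1)"
  proof -
    have "\<forall>\<^sub>F w in nhds s. w \<in> {w. Re w > 0} - {1}"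
      using assms by (intro eventually_nhds_in_open open_Diff open_halfspace_Re_gt) auto
    then show ?thesis by eventually_elim (use zeta_eq_zeta_reg in auto)
  qed
  have "(zeta_reg has_field_derivative deriv zeta_reg s) (at s)"
    using assms by (intro holomorphic_derivI[OF zeta_reg_holomorphic]) (auto simp: open_halfspace_Re_gt)
  then have "((\<lambda>w. zeta_reg w / (w - 1)) has_field_derivative
      ((deriv zeta_reg s * (s - 1) - zeta_reg s) / ((s - 1) * (s - 1)))) (at s)"
    using assms by (auto intro!: derivative_eq_intros)
  then have "deriv zeta s = (deriv zeta_reg s * (s - 1) - zeta_reg s) / ((s - 1) * (s - 1))"
    using deriv_cong_ev[OF ev refl] DERIV_imp_deriv by metis
  moreover have "zeta s = zeta_reg s / (s - 1)" using zeta_eq_zeta_reg assms by simp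
  moreover have eq: "((a' * r - a) / (r * r)) / (a / r) = a' / a - 1 / r"
    if "r \<noteq> 0" "a \<noteq> 0" for r a a' :: complex
    using that by (simp add: field_simps)
  ultimately have "deriv zeta s / zeta s = deriv zeta_reg s / zeta_reg s - 1 / (s - 1)"
    using eq[of "s - 1" "zeta_reg s" "deriv zeta_reg s"] assms by simp
  then show ?thesis by (simp add: h_formula_def h_reg_def)
qed

text \<open>At s = 1 the limit in the definition of \<open>h\<close> exists:
  \<open>zeta_reg 1 = 1\<close> makes \<open>h_reg\<close> continuous there, and
  \<open>h_formula\<close> agrees with it in a punctured neighbourhood.\<close>

lemma h_eq_h_reg:
  assumes "Re s \<ge> 1"
  shows "h s = h_reg s"
proof (cases "s = 1")
  case True
  have "isCont zeta_reg 1" "isCont (deriv zeta_reg) 1"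
    using zeta_reg_holomorphic holomorphic_deriv[OF zeta_reg_holomorphic open_halfspace_Re_gt]
    by (auto intro!: continuous_on_interior holomorphic_on_imp_continuous_on simp: interior_open open_halfspace_Re_gt)
  then have "isCont h_reg 1" unfolding h_reg_def[abs_def]
    by (intro continuous_intros) auto
  then have "h_reg \<midarrow>1\<rightarrow> h_reg 1" by (simp add: isCont_def)
  moreover have "\<forall>\<^sub>F s in at 1. h_formula s = h_reg s"
  proof -
    have "\<forall>\<^sub>F s in at 1. zeta_reg s \<noteq> 0"
      using \<open>isCont zeta_reg 1\<close> by (intro tendsto_imp_eventually_ne[of _ 1]) (auto simp: isCont_def)
    moreover have "\<forall>\<^sub>F s in at 1. s \<in> {s. Re s > 0}"
      by (intro eventually_at_in_open' open_halfspace_Re_gt) auto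
    moreover have "\<forall>\<^sub>F s in at (1 :: complex). s \<noteq> 1" by (rule eventually_neq_at_within)
    ultimately show ?thesis by eventually_elim (use h_formula_eq_h_reg in auto)
  qed
  ultimately have "h_formula \<midarrow>1\<rightarrow> h_reg 1" using tendsto_cong by metis
  then show ?thesis using True by (simp add: h_def tendsto_Lim)
next
  case False
  then show ?thesis using assms h_formula_eq_h_reg zeta_reg_nonzero by (simp add: h_def)
qed

text \<open>For |Im s| >= 1 the exponents of g', s(s + 1) and g combine to 1.1 - 2 - 0.6 = -1.5.
  Nearer the real axis continuity on a compact rectangle takes the place of the lower bound for
  g.\<close>

lemma h_reg_bound:
  obtains C where "C > 0" "\<And>s. 1 \<le> Re s \<Longrightarrow> Re s \<le> 2 \<Longrightarrow> norm (h_reg s) \<le> C * (1 + \<bar>Im s\<bar>) powr (- 1.5)"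
proof -
  obtain D where D: "D > 0" "\<And>s. 1 \<le> Re s \<Longrightarrow> Re s \<le> 2 \<Longrightarrow> norm (deriv zeta_reg s) \<le> D * (1 + \<bar>Im s\<bar>) powr 1.1"
    using deriv_zeta_reg_bound by blast
  obtain c where c: "c > 0" "\<And>s. 1 \<le> Re s \<Longrightarrow> Re s \<le> 2 \<Longrightarrow> \<bar>Im s\<bar> \<ge> 1 \<Longrightarrow>
     norm (zeta_reg s) \<ge> c * (1 + \<bar>Im s\<bar>) powr 0.6"
    using zeta_reg_lower_bound[of 1] by auto
  let ?R = "cbox (Complex 1 (-1)) (Complex 2 1)"
  have "compact (h_reg ` ?R)"
    by (intro compact_continuous_image continuous_on_subset[OF h_reg_continuous] compact_cbox)
       (auto simp: in_cbox_complex_iff)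
  then have "bounded (h_reg ` ?R)" by (rule compact_imp_bounded)
  then obtain E where E: "\<And>s. s \<in> ?R \<Longrightarrow> norm (h_reg s) \<le> E"
    unfolding bounded_iff by blast
  have "norm (h_reg (Complex 1 0)) \<le> E" by (intro E) (simp add: in_cbox_complex_iff)
  then have E0: "E \<ge> 0" using norm_ge_zero order_trans by blast
  show ?thesis
  \<comment> \<open>\<open>2 powr 1.5\<close> offsets the smallest decay factor over |Im s| <= 1;
    the 4 comes from the two bounds \<open>?B / 2\<close>.\<close>
  proof (rule that[of "max (E * 2 powr 1.5) (4 * D / c)"])
    show "max (E * 2 powr 1.5) (4 * D / c) > 0" using D c by (simp add: less_max_iff_disj)
    fix s assume s: "1 \<le> Re s" "Re s \<le> 2"
    let ?B = "1 + \<bar>Im s\<bar>"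
    show "norm (h_reg s) \<le> max (E * 2 powr 1.5) (4 * D / c) * ?B powr (- 1.5)"
    proof (cases "\<bar>Im s\<bar> \<ge> 1")
      case False
      then have "norm (h_reg s) \<le> E" using s by (intro E) (auto simp: in_cbox_complex_iff)
      also have "E = E * 2 powr 1.5 * 2 powr (- 1.5)" by (simp add: powr_minus)
      also have "\<dots> \<le> E * 2 powr 1.5 * ?B powr (- 1.5)"
        using E0 False by (intro mult_left_mono powr_mono2') auto
      also have "\<dots> \<le> max (E * 2 powr 1.5) (4 * D / c) * ?B powr (- 1.5)"
        by (intro mult_right_mono) auto
      finally show ?thesis .
    next
      case True
      have n: "norm s \<ge> ?B / 2" "norm (s + 1) \<ge> ?B / 2"
        using abs_Im_le_cmod[of s] abs_Im_le_cmod[of "s + 1"] True by auto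
      have "norm (h_reg s) = norm (deriv zeta_reg s) / (norm s * norm (s + 1) * norm (zeta_reg s))"
        by (simp add: h_reg_def norm_divide norm_mult)
      also have "\<dots> \<le> (D * ?B powr 1.1) / ((?B / 2) * (?B / 2) * (c * ?B powr 0.6))"
        using D c(2)[OF s True] n c(1) s by (intro frac_le mult_mono mult_pos_pos mult_nonneg_nonneg) auto
      also have "\<dots> = 4 * D / c * (?B powr 1.1 / (?B powr 2 * ?B powr 0.6))"
        by (simp add: power2_eq_square mult_ac)
      also have "?B powr 1.1 / (?B powr 2 * ?B powr 0.6) = ?B powr (- 1.5)"
        by (simp only: powr_add[symmetric] powr_diff[symmetric]) simp
      also have "4 * D / c * ?B powr (- 1.5) \<le> max (E * 2 powr 1.5) (4 * D / c) * ?B powr (- 1.5)"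
        by (intro mult_right_mono) auto
      finally show ?thesis .
    qed
  qed
qed

section \<open>The Perron kernel\<close>

text \<open>Common integrable majorant on vertical lines: the exponent is that of
  \<open>h_reg_bound\<close>, and the quadratic decay of the kernel is weakened to it.\<close>

definition decay :: "real \<Rightarrow> real" where
  "decay t = (1 + \<bar>t\<bar>) powr (- 1.5)"

lemma decay_pos: "decay t > 0"
proof -
  have "1 + \<bar>t\<bar> \<noteq> 0" by linarith
  then show ?thesis by (simp add: decay_def)
qed

lemma decay_integrable: "integrable lborel decay"
proof -
  define f where "f = (\<lambda>x::real. indicator {1..} x *\<^sub>R x powr (- 1.5))"
  have "(\<lambda>x::real. x powr (- 1.5)) integrable_on {1..}"
    using has_integral_powr_to_inf[of "- 1.5" 1] by (auto simp: integrable_on_def)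
  then have "(\<lambda>x::real. x powr (- 1.5)) absolutely_integrable_on {1..}"
    by (intro nonnegative_absolutely_integrable_1) auto
  then have "integrable lebesgue f" by (simp add: f_def set_integrable_def)
  then have f: "integrable lborel f"
    by (subst (asm) integrable_completion) (auto simp: f_def)
  \<comment> \<open>A translate and a reflection of the tail x^(-1.5) on x >= 1 cover t >= 0 and t
    <= 0; their overlap at 0 only enlarges the majorant.\<close>
  have "integrable lborel (\<lambda>t. f (1 + 1 * t))" "integrable lborel (\<lambda>t. f (1 + (- 1) * t))"
    by (intro lborel_integrable_real_affine[OF f]; simp)+
  then have "integrable lborel (\<lambda>t. f (1 + 1 * t) + f (1 + (- 1) * t))"
    by (intro Bochner_Integration.integrable_add)
  then show ?thesis
  proof (rule Bochner_Integration.integrable_bound)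
    show "decay \<in> borel_measurable lborel" unfolding decay_def[abs_def] by measurable
    show "AE t in lborel. norm (decay t) \<le> norm (f (1 + 1 * t) + f (1 + (- 1) * t))"
      by (intro AE_I2) (auto simp: decay_def f_def indicator_def abs_if)
  qed
qed

lemma integrable_decay_bound:
  fixes f :: "real \<Rightarrow> complex"
  assumes "continuous_on UNIV f" "\<And>t. norm (f t) \<le> C * decay t"
  shows "integrable lborel f"
proof (rule Bochner_Integration.integrable_bound)
  show "integrable lborel (\<lambda>t. C * decay t)" using decay_integrable by simp
  show "f \<in> borel_measurable lborel" using assms(1) by (simp add: borel_measurable_continuous_onI)
  show "AE t in lborel. norm (f t) \<le> norm (C * decay t)"
  proof (intro AE_I2)
    fix t show "norm (f t) \<le> norm (C * decay t)"
      using assms(2)[of t] by simp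
  qed
qed

text \<open>Links the truncated Henstock-Kurzweil integrals to which contour integrals reduce with
  the Lebesgue integral over the line.\<close>

lemma integral_symmetric_tendsto:
  fixes f :: "real \<Rightarrow> complex"
  assumes f: "integrable lborel f"
  shows "(\<lambda>n. integral {- real n..real n} f) \<longlonglongrightarrow> (LINT t|lborel. f t)"
proof -
  have "integral {- real n..real n} f = (LINT t|lborel. indicator {- real n..real n} t *\<^sub>R f t)" for n
  proof -
    have "set_integrable lborel {- real n..real n} f"
      unfolding set_integrable_def using f by (intro integrable_mult_indicator) auto
    then show ?thesis
      using set_borel_integral_eq_integral(2) by (metis set_lebesgue_integral_def)
  qed
  moreover have "(\<lambda>n. LINT t|lborel. indicator {- real n..real n} t *\<^sub>R f t) \<longlonglongrightarrow> (LINT t|lborel. f t)"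
  proof (rule integral_dominated_convergence[where w = "\<lambda>t. norm (f t)"])
    show "AE t in lborel. (\<lambda>n. indicator {- real n..real n} t *\<^sub>R f t) \<longlonglongrightarrow> f t"
    proof (intro AE_I2 tendsto_eventually)
      fix t :: real
      have "\<forall>\<^sub>F n in sequentially. \<bar>t\<bar> \<le> real n"
        using filterlim_real_sequentially by (simp add: filterlim_at_top)
      then show "\<forall>\<^sub>F n in sequentially. indicator {- real n..real n} t *\<^sub>R f t = f t"
        by eventually_elim (auto simp: indicator_def abs_le_iff)
    qed
    show "AE t in lborel. norm (indicator {- real n..real n} t *\<^sub>R f t) \<le> norm (f t)" for n
      by (intro AE_I2) (auto simp: indicator_def)
  qed (use f in \<open>auto simp: borel_measurable_integrable\<close>)
  ultimately show ?thesis by simp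
qed

definition perron_kernel :: "real \<Rightarrow> complex \<Rightarrow> complex" where
  "perron_kernel y s = exp (of_real y * s) / (s * (s + 1))"

lemma perron_kernel_holomorphic: "perron_kernel y holomorphic_on - {0, -1}"
  unfolding perron_kernel_def
  by (intro holomorphic_intros) (auto simp: add_eq_0_iff2)

lemma contour_integral_rectpath:
  assumes "continuous_on (path_image (rectpath a1 a3)) f"
  defines "a2 \<equiv> Complex (Re a3) (Im a1)" and "a4 \<equiv> Complex (Re a1) (Im a3)"
  shows "contour_integral (rectpath a1 a3) f =
    contour_integral (linepath a1 a2) f + contour_integral (linepath a2 a3) f +
    contour_integral (linepath a3 a4) f + contour_integral (linepath a4 a1) f"
proof -
  have "path_image (rectpath a1 a3) = closed_segment a1 a2 \<union> closed_segment a2 a3 \<union>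
          closed_segment a3 a4 \<union> closed_segment a4 a1"
    unfolding rectpath_def Let_def a2_def a4_def by (simp add: path_image_join Un_assoc)
  then have "f contour_integrable_on linepath a1 a2" "f contour_integrable_on linepath a2 a3"
    "f contour_integrable_on linepath a3 a4" "f contour_integrable_on linepath a4 a1"
    using assms(1) by (auto intro!: contour_integrable_continuous_linepath elim!: continuous_on_subset)
  then show ?thesis
    unfolding rectpath_def Let_def a2_def[symmetric] a4_def[symmetric] by (simp add: contour_integrable_joinI)
qed

lemma contour_integral_linepath_bound:
  assumes "continuous_on (closed_segment a b) f" "0 \<le> B"
    "\<And>x. x \<in> closed_segment a b \<Longrightarrow> norm (f x) \<le> B" "norm (b - a) \<le> l"
  shows "norm (contour_integral (linepath a b) f) \<le> B * l"
proof -
  have "norm (contour_integral (linepath a b) f) \<le> B * norm (b - a)"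
    using assms by (intro contour_integral_bound_linepath contour_integrable_continuous_linepath) auto
  also have "\<dots> \<le> B * l" using assms by (intro mult_left_mono) auto
  finally show ?thesis .
qed

text \<open>Keeping the closing sides at distance T + 1 from the origin leaves s + 1 a modulus of at
  least T, so one bound handles both denominators.\<close>

lemma perron_kernel_segment_bound:
  assumes "0 < T" "0 \<le> M" "norm (b - a) \<le> l"
    "\<And>s. s \<in> closed_segment a b \<Longrightarrow>
       norm (exp (of_real y * s)) \<le> M \<and> T + 1 \<le> norm s \<and> T \<le> norm (s + 1)"
  shows "norm (contour_integral (linepath a b) (perron_kernel y)) \<le> M / (T * T) * l"
proof (rule contour_integral_linepath_bound)
  have "s \<noteq> 0 \<and> s \<noteq> - 1" if "s \<in> closed_segment a b" for s
    using assms(4)[OF that] assms(1) by auto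
  then show "continuous_on (closed_segment a b) (perron_kernel y)"
    by (intro holomorphic_on_imp_continuous_on holomorphic_on_subset[OF perron_kernel_holomorphic]) auto
  fix s assume "s \<in> closed_segment a b"
  from assms(4)[OF this] have "norm (exp (of_real y * s)) \<le> M" "T \<le> norm s" "T \<le> norm (s + 1)" by auto
  then show "norm (perron_kernel y s) \<le> M / (T * T)"
    unfolding perron_kernel_def norm_divide norm_mult using assms by (intro frac_le mult_mono mult_pos_pos) auto
qed (use assms in auto)

lemma norm_exp_of_real_mult: "norm (exp (of_real y * s)) = exp (y * Re s)"
  by simp

text \<open>For y <= 0 the exponential is at most 1 in the right half-plane, where the kernel has no
  pole. The rectangle is therefore closed on the right; its other three sides have total length 4 (T
  + 1).\<close>

lemma perron_kernel_segment_neg: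
  assumes c: "c > 0" and y: "y \<le> 0" and T: "T > 0"
  shows "norm (contour_integral (linepath (Complex c (- T - 1)) (Complex c (T + 1))) (perron_kernel y))
           \<le> 1 / (T * T) * (4 * (T + 1))"
proof -
  define a1 a2 a3 a4 where a_def: "a1 = Complex c (- T - 1)" "a2 = Complex (c + T + 1) (- T - 1)"
     "a3 = Complex (c + T + 1) (T + 1)" "a4 = Complex c (T + 1)"
  let ?I = "\<lambda>a b. contour_integral (linepath a b) (perron_kernel y)"
  have sub: "path_image (rectpath a1 a3) \<subseteq> {s. Re s > 0}"
    using c T by (subst path_image_rectpath) (auto simp: a_def)
  have hol: "perron_kernel y holomorphic_on {s. Re s > 0}"
    by (rule holomorphic_on_subset[OF perron_kernel_holomorphic]) auto
  have "(perron_kernel y has_contour_integral 0) (rectpath a1 a3)"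
    by (rule Cauchy_theorem_convex_simple[OF hol convex_halfspace_Re_gt]) (use sub in auto)
  moreover have "contour_integral (rectpath a1 a3) (perron_kernel y) = ?I a1 a2 + ?I a2 a3 + ?I a3 a4 + ?I a4 a1"
    by (subst contour_integral_rectpath)
      (auto simp: a_def intro!: holomorphic_on_imp_continuous_on holomorphic_on_subset[OF hol] sub[unfolded a_def])
  moreover have "?I a4 a1 = - ?I a1 a4"
    by (intro contour_integral_reverse_linepath holomorphic_on_imp_continuous_on holomorphic_on_subset[OF hol])
      (use c T in \<open>auto simp: a_def closed_segment_same_Re\<close>)
  ultimately have "?I a1 a4 = ?I a1 a2 + ?I a2 a3 + ?I a3 a4"
    by (simp add: contour_integral_unique eq_neg_iff_add_eq_0)
  then have "norm (?I a1 a4) \<le> norm (?I a1 a2) + norm (?I a2 a3) + norm (?I a3 a4)"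
    using norm_triangle_mono by (metis norm_triangle_ineq order_refl)
  also have "\<dots> \<le> 1 / (T * T) * (T + 1) + 1 / (T * T) * (2 * (T + 1)) + 1 / (T * T) * (T + 1)"
  proof (intro add_mono perron_kernel_segment_bound)
    have exp_le: "norm (exp (of_real y * s)) \<le> 1" if "Re s > 0" for s
      using that y by (simp add: norm_exp_of_real_mult mult_nonpos_nonneg)
    have big: "T + 1 \<le> norm s \<and> T \<le> norm (s + 1)" if "T + 1 \<le> \<bar>Im s\<bar> \<or> T + 1 \<le> Re s" for s
      using that abs_Im_le_cmod[of s] abs_Im_le_cmod[of "s + 1"] abs_Re_le_cmod[of s] abs_Re_le_cmod[of "s + 1"] T
      by auto
    show "norm (exp (of_real y * s)) \<le> 1 \<and> T + 1 \<le> norm s \<and> T \<le> norm (s + 1)" if "s \<in> closed_segment a1 a2" for s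
      using that c T by (intro conjI[OF exp_le big]) (auto simp: a_def closed_segment_same_Im closed_segment_eq_real_ivl)
    show "norm (exp (of_real y * s)) \<le> 1 \<and> T + 1 \<le> norm s \<and> T \<le> norm (s + 1)" if "s \<in> closed_segment a2 a3" for s
      using that c T by (intro conjI[OF exp_le big]) (auto simp: a_def closed_segment_same_Re closed_segment_eq_real_ivl)
    show "norm (exp (of_real y * s)) \<le> 1 \<and> T + 1 \<le> norm s \<and> T \<le> norm (s + 1)" if "s \<in> closed_segment a3 a4" for s
      using that c T by (intro conjI[OF exp_le big]) (auto simp: a_def closed_segment_same_Im closed_segment_eq_real_ivl)
  qed (use T in \<open>auto simp: a_def norm_complex_def\<close>)
  also have "\<dots> = 1 / (T * T) * (4 * (T + 1))" using T by (simp add: field_simps)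
  finally show ?thesis by (simp add: a_def)
qed

lemma residue_perron_kernel:
  "residue (perron_kernel y) 0 = 1" "residue (perron_kernel y) (- 1) = - of_real (exp (- y))"
proof -
  have "residue (\<lambda>w. (exp (of_real y * w) / (w + 1)) / (w - 0)) 0 = exp (of_real y * 0) / (0 + 1)"
    by (rule residue_simple[of "- {-1}"]) (auto intro!: holomorphic_intros simp: add_eq_0_iff2)
  also have "(\<lambda>w. (exp (of_real y * w) / (w + 1)) / (w - 0)) = perron_kernel y"
    by (auto simp: perron_kernel_def fun_eq_iff mult.commute)
  finally show "residue (perron_kernel y) 0 = 1" by simp
  have "residue (\<lambda>w. (exp (of_real y * w) / w) / (w - (-1))) (-1) = exp (of_real y * (-1)) / (-1)"
    by (rule residue_simple[of "- {0}"]) (auto intro!: holomorphic_intros)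
  also have "(\<lambda>w. (exp (of_real y * w) / w) / (w - (-1))) = perron_kernel y"
    by (auto simp: perron_kernel_def fun_eq_iff)
  finally show "residue (perron_kernel y) (- 1) = - of_real (exp (- y))" 
    by (simp add: exp_of_real[of "- y", symmetric])
qed

text \<open>For y >= 0 the exponential is at most e^(cy) on Re s <= c, so the rectangle is closed on
  the left and encloses the poles 0 and -1. The other three sides have total length 4 (T + 1) +
  2c.\<close>

lemma perron_kernel_segment_pos:
  assumes c: "c > 0" and y: "y \<ge> 0" and T: "T > 0"
  shows "norm (contour_integral (linepath (Complex c (- T - 1)) (Complex c (T + 1))) (perron_kernel y)
           - 2 * of_real pi * \<i> * of_real (1 - exp (- y)))
           \<le> exp (c * y) / (T * T) * (4 * (T + 1) + 2 * c)"
proof -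
  define a1 a2 a3 a4 where a_def: "a1 = Complex (- T - 1) (- T - 1)" "a2 = Complex c (- T - 1)"
     "a3 = Complex c (T + 1)" "a4 = Complex (- T - 1) (T + 1)"
  let ?I = "\<lambda>a b. contour_integral (linepath a b) (perron_kernel y)"
  have sub: "path_image (rectpath a1 a3) \<subseteq> - {0, -1}"
    using c T by (subst path_image_rectpath) (auto simp: a_def)
  have in_box: "0 \<in> box a1 a3" "-1 \<in> box a1 a3"
    using c T by (auto simp: in_box_complex_iff a_def)
  have "contour_integral (rectpath a1 a3) (perron_kernel y) =
      2 * pi * \<i> * (\<Sum>p\<in>{0,-1}. winding_number (rectpath a1 a3) p * residue (perron_kernel y) p)"
    by (rule Residue_theorem[of UNIV])
      (use sub perron_kernel_holomorphic in \<open>auto simp: Compl_eq_Diff_UNIV\<close>)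
  also have "(\<Sum>p\<in>{0,-1}. winding_number (rectpath a1 a3) p * residue (perron_kernel y) p) = of_real (1 - exp (- y))"
    by (simp add: winding_number_rectpath[OF in_box(1)] winding_number_rectpath[OF in_box(2)] residue_perron_kernel)
  finally have "contour_integral (rectpath a1 a3) (perron_kernel y) = 2 * of_real pi * \<i> * of_real (1 - exp (- y))"
    by simp
  moreover have "contour_integral (rectpath a1 a3) (perron_kernel y) = ?I a1 a2 + ?I a2 a3 + ?I a3 a4 + ?I a4 a1"
    by (subst contour_integral_rectpath)
      (auto simp: a_def intro!: holomorphic_on_imp_continuous_on holomorphic_on_subset[OF perron_kernel_holomorphic] sub[unfolded a_def])
  ultimately have "?I a2 a3 - 2 * of_real pi * \<i> * of_real (1 - exp (- y)) = - (?I a1 a2 + ?I a3 a4 + ?I a4 a1)"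
    by (simp add: algebra_simps)
  then have "norm (?I a2 a3 - 2 * of_real pi * \<i> * of_real (1 - exp (- y))) = norm (?I a1 a2 + ?I a3 a4 + ?I a4 a1)"
    by (simp only: norm_minus_cancel)
  also have "\<dots> \<le> norm (?I a1 a2) + norm (?I a3 a4) + norm (?I a4 a1)"
    by (meson norm_triangle_ineq norm_triangle_mono order_refl)
  also have "\<dots> \<le> exp (c * y) / (T * T) * (c + T + 1) + exp (c * y) / (T * T) * (c + T + 1)
       + exp (c * y) / (T * T) * (2 * (T + 1))"
  proof (intro add_mono perron_kernel_segment_bound)
    have exp_le: "norm (exp (of_real y * s)) \<le> exp (c * y)" if "Re s \<le> c" for s
      using mult_left_mono[OF that y] by (simp add: norm_exp_of_real_mult mult.commute)
    have big: "T + 1 \<le> norm s \<and> T \<le> norm (s + 1)" if "T + 1 \<le> \<bar>Im s\<bar> \<or> T + 1 \<le> - Re s" for s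
      using that abs_Im_le_cmod[of s] abs_Im_le_cmod[of "s + 1"] abs_Re_le_cmod[of s] abs_Re_le_cmod[of "s + 1"] T
      by auto
    show "norm (exp (of_real y * s)) \<le> exp (c * y) \<and> T + 1 \<le> norm s \<and> T \<le> norm (s + 1)" if "s \<in> closed_segment a1 a2" for s
      using that c T by (intro conjI[OF exp_le big]) (auto simp: a_def closed_segment_same_Im closed_segment_eq_real_ivl)
    show "norm (exp (of_real y * s)) \<le> exp (c * y) \<and> T + 1 \<le> norm s \<and> T \<le> norm (s + 1)" if "s \<in> closed_segment a3 a4" for s
      using that c T by (intro conjI[OF exp_le big]) (auto simp: a_def closed_segment_same_Im closed_segment_eq_real_ivl)
    show "norm (exp (of_real y * s)) \<le> exp (c * y) \<and> T + 1 \<le> norm s \<and> T \<le> norm (s + 1)" if "s \<in> closed_segment a4 a1" for s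
      using that c T by (intro conjI[OF exp_le big]) (auto simp: a_def closed_segment_same_Re closed_segment_eq_real_ivl)
  qed (use T c in \<open>auto simp: a_def norm_complex_def\<close>)
  also have "\<dots> = exp (c * y) / (T * T) * (4 * (T + 1) + 2 * c)" using T by (simp add: field_simps)
  finally show ?thesis by (simp add: a_def)
qed

lemma perron_kernel_bound:
  assumes c: "c > 0"
  shows "norm (perron_kernel y (Complex c t)) \<le> 4 / min 1 c * exp (c * y) * decay t"
proof -
  \<comment> \<open>|s| >= (c + |t|) / 2 has to be compared with 1 + |t|; the minimum also handles c
    < 1, which occurs on the shifted line of the pole term.\<close>
  let ?m = "min 1 c" and ?B = "1 + \<bar>t\<bar>" and ?s = "Complex c t"
  have m: "?m > 0" "?m \<le> 1" "?m \<le> c" using c by auto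
  have "?m * ?B \<le> c + \<bar>t\<bar>" using m mult_right_mono[of ?m 1 "\<bar>t\<bar>"] by (simp add: distrib_left)
  moreover have "c + \<bar>t\<bar> \<le> 2 * norm ?s"
    using abs_Re_le_cmod[of ?s] abs_Im_le_cmod[of ?s] by simp
  ultimately have n1: "norm ?s \<ge> ?m * ?B / 2" by simp
  have n2: "norm (?s + 1) \<ge> ?B / 2"
    using abs_Re_le_cmod[of "?s + 1"] abs_Im_le_cmod[of "?s + 1"] c by simp
  have B: "?B > 0" by simp
  have "norm (perron_kernel y ?s) \<le> exp (c * y) / ((?m * ?B / 2) * (?B / 2))"
    unfolding perron_kernel_def norm_divide norm_mult norm_exp_of_real_mult
    using n1 n2 m B by (intro frac_le mult_mono mult_pos_pos) (auto simp: mult.commute)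
  also have "\<dots> = 4 / ?m * exp (c * y) * ?B powr (- 2)"
    using B m by (simp add: powr_minus powr_numeral power2_eq_square divide_simps)
  also have "\<dots> \<le> 4 / ?m * exp (c * y) * decay t"
    unfolding decay_def using m by (intro mult_left_mono powr_mono) auto
  finally show ?thesis .
qed

lemma continuous_on_Complex: "continuous_on A (\<lambda>t. Complex c t)"
  unfolding Complex_eq by (intro continuous_intros)

lemma perron_kernel_continuous:
  assumes "c > 0"
  shows "continuous_on UNIV (\<lambda>t. perron_kernel y (Complex c t))"
proof (rule continuous_on_compose2[OF holomorphic_on_imp_continuous_on[OF perron_kernel_holomorphic] continuous_on_Complex])
  show "range (Complex c) \<subseteq> - {0, - 1}"
    using assms by (auto simp: complex_eq_iff)
qed

lemma perron_kernel_integrable: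
  assumes "c > 0"
  shows "integrable lborel (\<lambda>t. perron_kernel y (Complex c t))"
  by (rule integrable_decay_bound[OF perron_kernel_continuous[OF assms] perron_kernel_bound[OF assms]])

text \<open>The factor i turns dt into ds, so the truncated integrals become contour integrals over
  segments of half-height n + 1, whose distance from the limit is O(1/n).\<close>

lemma perron_kernel_integral:
  assumes c: "c > 0"
  shows "(LINT t|lborel. perron_kernel y (Complex c t)) = 2 * of_real pi * of_real (max 0 (1 - exp (- y)))"
proof -
  let ?L = "2 * of_real pi * \<i> * of_real (max 0 (1 - exp (- y))) :: complex"
  define J where "J = (\<lambda>n. contour_integral (linepath (Complex c (- real n - 1)) (Complex c (real n + 1))) (perron_kernel y))"
  have "(\<lambda>n. integral {- real (Suc n)..real (Suc n)} (\<lambda>t. perron_kernel y (Complex c t)))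
      \<longlonglongrightarrow> (LINT t|lborel. perron_kernel y (Complex c t))"
    using LIMSEQ_Suc[OF integral_symmetric_tendsto[OF perron_kernel_integrable[OF c]]] .
  then have "(\<lambda>n. \<i> * integral {- real (Suc n)..real (Suc n)} (\<lambda>t. perron_kernel y (Complex c t)))
      \<longlonglongrightarrow> \<i> * (LINT t|lborel. perron_kernel y (Complex c t))"
    by (intro tendsto_intros)
  moreover have "J = (\<lambda>n. \<i> * integral {- real (Suc n)..real (Suc n)} (\<lambda>t. perron_kernel y (Complex c t)))"
    unfolding J_def by (intro ext contour_integral_linepath_same_Re) auto
  ultimately have 1: "J \<longlonglongrightarrow> \<i> * (LINT t|lborel. perron_kernel y (Complex c t))" by (simp only:)
  have "\<forall>\<^sub>F n in sequentially. norm (J n - ?L) \<le> exp (c * \<bar>y\<bar>) / (real n * real n) * (4 * (real n + 1) + 2 * c)"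
    using eventually_gt_at_top[of 0]
  proof eventually_elim
    case (elim n)
    show ?case
    proof (cases "y \<ge> 0")
      case True
      then show ?thesis using perron_kernel_segment_pos[OF c True, of "real n"] elim
        by (simp add: J_def max_def)
    next
      case False
      then have y: "y \<le> 0" by simp
      have "norm (J n - ?L) = norm (J n)" using y by (simp add: max_def)
      also have "\<dots> \<le> 1 / (real n * real n) * (4 * (real n + 1))"
        using perron_kernel_segment_neg[OF c y, of "real n"] elim by (simp add: J_def)
      also have "\<dots> \<le> exp (c * \<bar>y\<bar>) / (real n * real n) * (4 * (real n + 1) + 2 * c)"
        using c by (intro mult_mono divide_right_mono) auto
      finally show ?thesis .
    qed
  qed
  moreover have "(\<lambda>n. exp (c * \<bar>y\<bar>) / (real n * real n) * (4 * (real n + 1) + 2 * c)) \<longlonglongrightarrow> 0"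
    by real_asymp
  ultimately have "(\<lambda>n. J n - ?L) \<longlonglongrightarrow> 0"
    by (rule Lim_null_comparison)
  then have "J \<longlonglongrightarrow> ?L" by (simp add: LIM_zero_iff)
  with 1 have "\<i> * (LINT t|lborel. perron_kernel y (Complex c t)) = ?L" by (rule LIMSEQ_unique)
  then have "\<i> * (LINT t|lborel. perron_kernel y (Complex c t)) = \<i> * (2 * of_real pi * of_real (max 0 (1 - exp (- y))))"
    by (simp add: mult_ac)
  then show ?thesis by (metis complex_i_not_zero mult_left_cancel)
qed

section \<open>The formula for psi1 and the prime number theorem\<close>

lemma h_reg_eq_log_zeta:
  assumes "Re s > 1"
  shows "h_reg s = (- deriv log_zeta s - 1 / (s - 1)) / (s * (s + 1))"
proof -
  have ev: "\<forall>\<^sub>F w in nhds s. zeta w = zeta_series w"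
  proof -
    have "\<forall>\<^sub>F w in nhds s. w \<in> {w. Re w > 1}"
      using assms by (intro eventually_nhds_in_open open_halfspace_Re_gt) auto
    then show ?thesis by eventually_elim (use zeta_eq_series in auto)
  qed
  have "s \<noteq> 1" using assms by auto
  then have nz: "zeta_series s \<noteq> 0"
    using zeta_series_eq_zeta_reg[OF assms] zeta_reg_nonzero[of s] assms by simp
  have "deriv zeta s / zeta s = deriv log_zeta s"
    using deriv_cong_ev[OF ev refl] deriv_zeta_series[OF assms] zeta_eq_series[OF assms] nz by simp
  then have "h_formula s = (- deriv log_zeta s - 1 / (s - 1)) / (s * (s + 1))"
    by (simp add: h_formula_def)
  moreover have "h_formula s = h_reg s"
    using assms \<open>s \<noteq> 1\<close> by (intro h_formula_eq_h_reg zeta_reg_nonzero) auto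
  ultimately show ?thesis by simp
qed

text \<open>The term of index n is present in \<open>psi t\<close> exactly for t >= n, so it
  contributes \<open>mangoldt n\<close> times the length of the interval from n to x.\<close>

lemma psi_has_integral:
  assumes "x \<ge> 1"
  shows "(psi has_integral (\<Sum>n | 1 \<le> n \<and> real n \<le> x. mangoldt n * (x - real n))) {1..x}"
proof -
  let ?N = "{n. 1 \<le> n \<and> real n \<le> x}"
  have fin: "finite ?N"
    by (rule finite_subset[of _ "{..nat \<lfloor>x\<rfloor>}"]) (auto simp: le_nat_floor)
  have "((\<lambda>t. \<Sum>n\<in>?N. if t \<in> {real n..x} then mangoldt n else 0) has_integral
          (\<Sum>n\<in>?N. mangoldt n * (x - real n))) {1..x}"
  proof (rule has_integral_sum[OF fin])
    fix n assume n: "n \<in> ?N"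
    have "((\<lambda>t. mangoldt n :: real) has_integral mangoldt n * (x - real n)) {real n..x}"
      using has_integral_const_real[of "mangoldt n :: real" "real n" x] n by (simp add: mult.commute)
    then show "((\<lambda>t. if t \<in> {real n..x} then mangoldt n else 0) has_integral mangoldt n * (x - real n)) {1..x}"
      using n by (subst has_integral_restrict) auto
  qed
  then show ?thesis
  proof (rule has_integral_eq[rotated])
    fix t assume t: "t \<in> {1..x}"
    have "psi t = (\<Sum>n\<in>?N \<inter> {n. real n \<le> t}. mangoldt n)"
      unfolding psi_def using t by (intro sum.cong) auto
    also have "\<dots> = (\<Sum>n\<in>?N. if real n \<le> t then mangoldt n else 0)"
      by (subst sum.inter_restrict[OF fin]) auto
    also have "\<dots> = (\<Sum>n\<in>?N. if t \<in> {real n..x} then mangoldt n else 0)"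
      using t by (intro sum.cong) auto
    finally show "(\<Sum>n\<in>?N. if t \<in> {real n..x} then mangoldt n else 0) = psi t" by simp
  qed
qed

lemma psi1_eq_sum:
  assumes "x \<ge> 1"
  shows "psi1 x = (\<Sum>n | 1 \<le> n \<and> real n \<le> x. mangoldt n * (x - real n))"
  unfolding psi1_def by (rule integral_unique[OF psi_has_integral[OF assms]])

lemma psi_integrable_on: "1 \<le> a \<Longrightarrow> psi integrable_on {a..b}"
proof (cases "1 \<le> b")
  case True
  then have "psi integrable_on {1..b}" using psi_has_integral by (auto simp: integrable_on_def)
  then show "psi integrable_on {a..b}" if "1 \<le> a"
    by (rule integrable_on_subinterval) (use that in auto)
qed auto

lemma psi_mono:
  assumes "a \<le> b"
  shows "psi a \<le> psi b"
  unfolding psi_def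
proof (rule sum_mono2)
  show "finite {n. 1 \<le> n \<and> real n \<le> b}"
    by (rule finite_subset[of _ "{..nat \<lfloor>b\<rfloor>}"]) (auto simp: le_nat_floor)
qed (use assms mangoldt_nonneg in auto)

lemma psi1_diff_bounds:
  assumes "1 \<le> a" "a \<le> b"
  shows "(b - a) * psi a \<le> psi1 b - psi1 a" "psi1 b - psi1 a \<le> (b - a) * psi b"
proof -
  have eq: "psi1 b - psi1 a = integral {a..b} psi"
    unfolding psi1_def using Henstock_Kurzweil_Integration.integral_combine[OF assms psi_integrable_on] by simp
  have int: "psi integrable_on {a..b}" using assms by (intro psi_integrable_on)
  have "integral {a..b} (\<lambda>_. psi a) \<le> integral {a..b} psi"
    by (rule integral_le[OF _ int]) (auto intro: psi_mono)
  then show "(b - a) * psi a \<le> psi1 b - psi1 a" using assms eq by simp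
  have "integral {a..b} psi \<le> integral {a..b} (\<lambda>_. psi b)"
    by (rule integral_le[OF int]) (auto intro: psi_mono)
  then show "psi1 b - psi1 a \<le> (b - a) * psi b" using assms eq by simp
qed

text \<open>The weights are the kernel integrals at y = ln x - ln (n + 1), up to the factor 2 pi;
  the maximum with 0 extends the finite sum to a series.\<close>

lemma psi1_div_sums:
  assumes "x \<ge> 1"
  shows "(\<lambda>n. mangoldt (Suc n) * max 0 (1 - real (Suc n) / x)) sums (psi1 x / x)"
proof -
  define g where "g = (\<lambda>n. mangoldt n * max 0 (1 - real n / x) :: real)"
  let ?N = "{n. 1 \<le> n \<and> real n \<le> x}"
  have N: "?N = Suc ` {..<nat \<lfloor>x\<rfloor>}"
  proof (intro set_eqI iffI)
    fix n assume "n \<in> ?N"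
    then have "n = Suc (n - 1)" "n - 1 < nat \<lfloor>x\<rfloor>" using le_nat_floor[of n x] by auto
    then show "n \<in> Suc ` {..<nat \<lfloor>x\<rfloor>}" by blast
  next
    fix n assume "n \<in> Suc ` {..<nat \<lfloor>x\<rfloor>}"
    then have "1 \<le> n" "n \<le> nat \<lfloor>x\<rfloor>" by auto
    then show "n \<in> ?N" using assms by (auto simp: le_nat_iff le_floor_iff)
  qed
  have "psi1 x / x = (\<Sum>n\<in>?N. g n)"
    unfolding psi1_eq_sum[OF assms] sum_divide_distrib
    using assms by (intro sum.cong) (auto simp: g_def max_def field_simps)
  also have "\<dots> = (\<Sum>n<nat \<lfloor>x\<rfloor>. g (Suc n))"
    unfolding N by (subst sum.reindex) auto
  finally have "psi1 x / x = (\<Sum>n<nat \<lfloor>x\<rfloor>. g (Suc n))" .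
  moreover have "(\<lambda>n. g (Suc n)) sums (\<Sum>n<nat \<lfloor>x\<rfloor>. g (Suc n))"
  proof (rule sums_finite)
    fix n assume "n \<notin> {..<nat \<lfloor>x\<rfloor>}"
    then have "real (Suc n) \<ge> x" by simp linarith
    then have "1 - real (Suc n) / x \<le> 0" using assms by (simp add: field_simps)
    then show "g (Suc n) = 0" by (simp only: g_def max_absorb1 mult_zero_right)
  qed auto
  ultimately show ?thesis by (simp only: g_def)
qed

text \<open>Termwise integration, with the kernel at y = ln x - ln (n + 1). \<open>f_bound\<close>
  justifies the interchange: up to a constant the terms are dominated by the summands of
  \<open>summable_mangoldt_powr\<close> times \<open>decay\<close>, and c > 1 makes these
  summable.\<close>

lemma mangoldt_perron_integral:
  assumes c: "c > 1" and x: "x \<ge> 1"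
  defines "A \<equiv> \<lambda>t. exp (of_real (ln x) * Complex c t) / (Complex c t * (Complex c t + 1)) *
                 (- deriv log_zeta (Complex c t))"
  shows "integrable lborel A" "(LINT t|lborel. A t) = 2 * of_real pi * of_real (psi1 x / x)"
proof -
  let ?y = "\<lambda>n. ln x - ln (real (Suc n))"
  define f where "f = (\<lambda>n t. of_real (mangoldt (Suc n)) * perron_kernel (?y n) (Complex c t))"
  have c0: "c > 0" using c by simp
  have f_int: "integrable lborel (f n)" for n
    unfolding f_def using perron_kernel_integrable[OF c0] by simp
  have sums: "(\<lambda>n. f n t) sums A t" for t
  proof -
    let ?s = "Complex c t"
    have "f n t = exp (of_real (ln x) * ?s) / (?s * (?s + 1)) * (of_real (mangoldt (Suc n)) * of_nat (Suc n) powr (- ?s))" for n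
    proof -
      have "of_nat (Suc n) powr (- ?s) = exp (- of_real (ln (real (Suc n))) * ?s)"
        using Ln_of_real[of "real (Suc n)"] by (simp add: powr_def mult.commute del: of_nat_Suc)
      moreover have "exp (of_real (?y n) * ?s) = exp (of_real (ln x) * ?s) * exp (- of_real (ln (real (Suc n))) * ?s)"
        by (simp add: ring_distribs flip: exp_add del: of_nat_Suc)
      ultimately show ?thesis by (simp add: f_def perron_kernel_def del: of_nat_Suc)
    qed
    moreover have "(\<lambda>n. exp (of_real (ln x) * ?s) / (?s * (?s + 1)) * (of_real (mangoldt (Suc n)) * of_nat (Suc n) powr (- ?s))) sums A t"
      unfolding A_def using c by (intro sums_mult mangoldt_series_sums) auto
    ultimately show ?thesis by simp
  qed
  define M where "M = (\<lambda>n. 4 * exp (c * ln x) * (mangoldt (Suc n) * real (Suc n) powr (- c)))"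
  have f_bound: "norm (f n t) \<le> M n * decay t" for n t
  proof -
    have "norm (perron_kernel (?y n) (Complex c t)) \<le> 4 / min 1 c * exp (c * ?y n) * decay t"
      by (rule perron_kernel_bound[OF c0])
    also have "exp (c * ?y n) = exp (c * ln x) * real (Suc n) powr (- c)"
      by (simp add: powr_def ring_distribs mult.commute flip: exp_add del: of_nat_Suc)
    finally have "norm (f n t) \<le> mangoldt (Suc n) * (4 * (exp (c * ln x) * real (Suc n) powr (- c)) * decay t)"
      unfolding f_def norm_mult norm_of_real abs_mangoldt using c mangoldt_nonneg by (intro mult_left_mono) (auto simp: min_def)
    then show ?thesis by (simp add: M_def mult_ac)
  qed
  have M: "summable M" unfolding M_def by (intro summable_mult summable_mangoldt_powr c)
  have sum_norm: "summable (\<lambda>n. norm (f n t))" for t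
    by (rule summable_comparison_test'[OF summable_mult2[OF M, of "decay t"]]) (use f_bound in simp)
  have sum_int: "summable (\<lambda>n. LINT t|lborel. norm (f n t))"
  proof (rule summable_comparison_test'[OF summable_mult2[OF M, of "LINT t|lborel. decay t"]])
    fix n
    have "(LINT t|lborel. norm (f n t)) \<le> (LINT t|lborel. M n * decay t)"
      by (intro integral_mono integrable_norm f_int f_bound) (use decay_integrable in simp)
    also have "\<dots> = M n * (LINT t|lborel. decay t)" by simp
    finally show "norm (LINT t|lborel. norm (f n t)) \<le> M n * (LINT t|lborel. decay t)" by simp
  qed
  have A_eq: "A = (\<lambda>t. \<Sum>n. f n t)" using sums by (auto simp: sums_iff fun_eq_iff)
  show "integrable lborel A"
    unfolding A_eq by (rule integrable_suminf[OF f_int _ sum_int]) (use sum_norm in simp)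
  have "(\<lambda>n. LINT t|lborel. f n t) sums (LINT t|lborel. A t)"
    unfolding A_eq by (rule sums_integral[OF f_int _ sum_int]) (use sum_norm in simp)
  moreover have "(\<lambda>n. LINT t|lborel. f n t) = (\<lambda>n. 2 * of_real pi * of_real (mangoldt (Suc n) * max 0 (1 - real (Suc n) / x)))"
  proof
    fix n
    have "exp (- ?y n) = real (Suc n) / x"
      using x by (simp add: exp_diff del: of_nat_Suc)
    then show "(LINT t|lborel. f n t) = 2 * of_real pi * of_real (mangoldt (Suc n) * max 0 (1 - real (Suc n) / x))"
      unfolding f_def by (simp add: perron_kernel_integral[OF c0] del: of_nat_Suc)
  qed
  moreover have "(\<lambda>n. 2 * of_real pi * of_real (mangoldt (Suc n) * max 0 (1 - real (Suc n) / x)) :: complex) sums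
      (2 * of_real pi * of_real (psi1 x / x))"
    by (intro sums_mult sums_of_real psi1_div_sums[OF x])
  ultimately show "(LINT t|lborel. A t) = 2 * of_real pi * of_real (psi1 x / x)"
    using sums_unique2 by metis
qed

text \<open>Partial fractions: 1/((s - 1) s (s + 1)) is half of 1/((s - 1) s) - 1/(s (s + 1)). Both
  are kernels, the first on the line c - 1 > 0, where the shift of s by 1 produces a factor
  x.\<close>

lemma pole_perron_integral:
  assumes c: "c > 1" and x: "x \<ge> 1"
  defines "A \<equiv> \<lambda>t. exp (of_real (ln x) * Complex c t) / (Complex c t * (Complex c t + 1)) * (1 / (Complex c t - 1))"
  shows "integrable lborel A" "(LINT t|lborel. A t) = 2 * of_real pi * of_real (x / 2 * (1 - 1 / x)\<^sup>2)"
proof -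
  let ?K = "\<lambda>c t. perron_kernel (ln x) (Complex c t)"
  have A_eq: "A = (\<lambda>t. 1 / 2 * (of_real x * ?K (c - 1) t - ?K c t))"
  proof
    fix t
    define s where "s = Complex c t"
    have s: "s \<noteq> 0" "s \<noteq> 1" "s + 1 \<noteq> 0" using c by (auto simp: s_def complex_eq_iff)
    have s1: "Complex (c - 1) t = s - 1" by (simp add: s_def complex_eq_iff)
    have ex: "exp (of_real (ln x) * s) = of_real x * exp (of_real (ln x) * (s - 1))"
    proof -
      have "of_real x = exp (of_real (ln x) :: complex)" using x by (simp add: exp_of_real)
      then show ?thesis by (simp add: right_diff_distrib flip: exp_add)
    qed
    have "1 / (s * (s + 1)) * (1 / (s - 1)) = 1 / 2 * (1 / ((s - 1) * s) - 1 / (s * (s + 1)))"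
      using s by (simp add: divide_simps)
    moreover have half_diff: "E * (1 / 2 * (Q - R)) = 1 / 2 * (E * Q - E * R)" for E Q R :: complex
      by (simp only: mult.left_commute[of E] right_diff_distrib[of E])
    ultimately have "exp (of_real (ln x) * s) * (1 / (s * (s + 1)) * (1 / (s - 1))) =
        1 / 2 * (exp (of_real (ln x) * s) * (1 / ((s - 1) * s)) - exp (of_real (ln x) * s) * (1 / (s * (s + 1))))"
      by (simp only: half_diff)
    moreover have "exp (of_real (ln x) * s) * (1 / ((s - 1) * s)) = of_real x * perron_kernel (ln x) (s - 1)"
      unfolding ex perron_kernel_def by simp
    ultimately show "A t = 1 / 2 * (of_real x * ?K (c - 1) t - ?K c t)"
      unfolding A_def s1 s_def[symmetric] by (simp add: perron_kernel_def)
  qed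
  have int: "integrable lborel (?K (c - 1))" "integrable lborel (?K c)"
    using c by (auto intro!: perron_kernel_integrable)
  then show "integrable lborel A" unfolding A_eq by simp
  have "exp (- ln x) = 1 / x" using x by (simp add: exp_minus inverse_eq_divide)
  then have mx: "max 0 (1 - exp (- ln x)) = 1 - 1 / x" using x by (simp add: max_def)
  have "(LINT t|lborel. A t) = 1 / 2 * (of_real x * (2 * of_real pi * of_real (1 - 1 / x)) - 2 * of_real pi * of_real (1 - 1 / x))"
    using int c unfolding A_eq by (simp add: perron_kernel_integral mx)
  also have "\<dots> = of_real (1 / 2 * (x * (2 * pi * (1 - 1 / x)) - 2 * pi * (1 - 1 / x)))" by simp
  also have "1 / 2 * (x * (2 * pi * (1 - 1 / x)) - 2 * pi * (1 - 1 / x)) = 2 * pi * (x / 2 * (1 - 1 / x)\<^sup>2)"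
    using x by (simp add: field_simps power2_eq_square)
  finally show "(LINT t|lborel. A t) = 2 * of_real pi * of_real (x / 2 * (1 - 1 / x)\<^sup>2)" by simp
qed

lemma h_reg_integral_right:
  assumes c: "c > 1" and x: "x \<ge> 1"
  shows "(LINT t|lborel. exp (of_real (ln x) * Complex c t) * h_reg (Complex c t)) =
           2 * of_real pi * of_real (psi1 x / x - x / 2 * (1 - 1 / x)\<^sup>2)"
proof -
  have "exp (of_real (ln x) * Complex c t) * h_reg (Complex c t) =
     exp (of_real (ln x) * Complex c t) / (Complex c t * (Complex c t + 1)) * (- deriv log_zeta (Complex c t)) -
     exp (of_real (ln x) * Complex c t) / (Complex c t * (Complex c t + 1)) * (1 / (Complex c t - 1))" for t
    using c by (subst h_reg_eq_log_zeta) (simp_all add: diff_divide_distrib algebra_simps)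
  then show ?thesis
    using mangoldt_perron_integral[OF assms] pole_perron_integral[OF assms]
    by (simp add: right_diff_distrib)
qed

section \<open>Passage to the line Re s = 1\<close>

lemma h_reg_line_continuous:
  assumes "c \<ge> 1"
  shows "continuous_on UNIV (\<lambda>t. h_reg (Complex c t))"
  by (rule continuous_on_compose2[OF h_reg_continuous continuous_on_Complex]) (use assms in auto)

lemma h_reg_decay:
  obtains C where "\<And>c t. 1 \<le> c \<Longrightarrow> c \<le> 2 \<Longrightarrow> norm (h_reg (Complex c t)) \<le> C * decay t"
proof (rule h_reg_bound)
  fix C assume C: "\<And>s. 1 \<le> Re s \<Longrightarrow> Re s \<le> 2 \<Longrightarrow> norm (h_reg s) \<le> C * (1 + \<bar>Im s\<bar>) powr (- 1.5)"
  show ?thesis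
    by (rule that[of C]) (use C[of "Complex c t" for c t] in \<open>simp add: decay_def\<close>)
qed

lemma h_reg_line_integrable: "integrable lborel (\<lambda>t. h_reg (Complex 1 t))"
proof -
  obtain C where C: "\<And>c t. 1 \<le> c \<Longrightarrow> c \<le> 2 \<Longrightarrow> norm (h_reg (Complex c t)) \<le> C * decay t"
    by (rule h_reg_decay) blast
  from C[of 1] show ?thesis
    by (intro integrable_decay_bound[where C = C] h_reg_line_continuous) auto
qed

lemma psi1_formula:
  assumes x: "x \<ge> 1"
  shows "of_real (psi1 x / x\<^sup>2 - 1 / 2 * (1 - 1 / x)\<^sup>2) =
    1 / (2 * of_real pi) * (LINT t|lborel. h_reg (Complex 1 t) * exp (\<i> * of_real t * of_real (ln x)))"
proof -
  let ?R = "2 * of_real pi * of_real (psi1 x / x - x / 2 * (1 - 1 / x)\<^sup>2) :: complex"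
  define F where "F = (\<lambda>c t. exp (of_real (ln x) * Complex c t) * h_reg (Complex c t))"
  \<comment> \<open>Abscissae approaching 1 from the right within (1, 2], where the formula off the
    line and the uniform decay bound both hold.\<close>
  define \<gamma> where "\<gamma> = (\<lambda>n. 1 + 1 / real (Suc n))"
  have \<gamma>: "1 < \<gamma> n" "\<gamma> n \<le> 2" for n by (auto simp: \<gamma>_def field_simps)
  have \<gamma>_lim: "\<gamma> \<longlonglongrightarrow> 1" unfolding \<gamma>_def by real_asymp
  obtain C where C: "\<And>c t. 1 \<le> c \<Longrightarrow> c \<le> 2 \<Longrightarrow> norm (h_reg (Complex c t)) \<le> C * decay t"
    by (rule h_reg_decay) blast
  have F_cont: "continuous_on UNIV (F c)" if "c \<ge> 1" for c
    unfolding F_def by (intro continuous_intros continuous_on_Complex h_reg_line_continuous that)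
  have "(\<lambda>n. LINT t|lborel. F (\<gamma> n) t) \<longlonglongrightarrow> (LINT t|lborel. F 1 t)"
  \<comment> \<open>\<open>x\<^sup>2\<close> bounds |x^s| for Re s <= 2, uniformly in n.\<close>
  proof (rule integral_dominated_convergence[where w = "\<lambda>t. x\<^sup>2 * C * decay t"])
    show "F 1 \<in> borel_measurable lborel" "F (\<gamma> n) \<in> borel_measurable lborel" for n
      using F_cont[of 1] F_cont[of "\<gamma> n"] \<gamma>[of n] by (simp_all add: borel_measurable_continuous_onI)
    show "integrable lborel (\<lambda>t. x\<^sup>2 * C * decay t)" using decay_integrable by simp
    show "AE t in lborel. norm (F (\<gamma> n) t) \<le> x\<^sup>2 * C * decay t" for n
    proof (intro AE_I2)
      fix t
      have "norm (exp (of_real (ln x) * Complex (\<gamma> n) t)) = exp (ln x * \<gamma> n)" by simp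
      also have "\<dots> \<le> exp (ln x * 2)" using x \<gamma>[of n] by (simp add: mult_left_mono)
      also have "\<dots> = x\<^sup>2" using exp_double[of "ln x"] x by (simp add: mult.commute)
      finally have "norm (F (\<gamma> n) t) \<le> x\<^sup>2 * (C * decay t)"
        unfolding F_def norm_mult using C[of "\<gamma> n" t] \<gamma>[of n]
        by (intro mult_mono) auto
      then show "norm (F (\<gamma> n) t) \<le> x\<^sup>2 * C * decay t" by (simp add: mult.assoc)
    qed
    show "AE t in lborel. (\<lambda>n. F (\<gamma> n) t) \<longlonglongrightarrow> F 1 t"
    proof (intro AE_I2)
      fix t
      have lim: "(\<lambda>n. Complex (\<gamma> n) t) \<longlonglongrightarrow> Complex 1 t"
        using \<gamma>_lim by (intro tendsto_Complex) auto
      have "(\<lambda>n. h_reg (Complex (\<gamma> n) t)) \<longlonglongrightarrow> h_reg (Complex 1 t)"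
        by (rule continuous_on_tendsto_compose[OF h_reg_continuous lim]) (use \<gamma> in \<open>auto simp: less_imp_le\<close>)
      then show "(\<lambda>n. F (\<gamma> n) t) \<longlonglongrightarrow> F 1 t"
        unfolding F_def by (intro tendsto_intros lim)
    qed
  qed
  moreover have "(LINT t|lborel. F (\<gamma> n) t) = ?R" for n
    unfolding F_def by (rule h_reg_integral_right[OF \<gamma>(1) x])
  ultimately have "(LINT t|lborel. F 1 t) = ?R"
    by (simp add: LIMSEQ_const_iff)
  \<comment> \<open>x^(1 + it) is x times the oscillating factor; dividing by this x turns psi1 x /
    x into psi1 x / x^2.\<close>
  moreover have "F 1 = (\<lambda>t. of_real x * (h_reg (Complex 1 t) * exp (\<i> * of_real t * of_real (ln x))))"
  proof
    fix t
    have "of_real x = exp (of_real (ln x) :: complex)" using x by (simp add: exp_of_real)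
    moreover have "of_real (ln x) * Complex 1 t = of_real (ln x) + \<i> * of_real t * of_real (ln x)"
      by (simp add: complex_eq_iff)
    ultimately show "F 1 t = of_real x * (h_reg (Complex 1 t) * exp (\<i> * of_real t * of_real (ln x)))"
      unfolding F_def by (simp add: exp_add)
  qed
  ultimately have eq: "of_real x * (LINT t|lborel. h_reg (Complex 1 t) * exp (\<i> * of_real t * of_real (ln x))) = ?R"
    by simp
  have "psi1 x / x\<^sup>2 - 1 / 2 * (1 - 1 / x)\<^sup>2 = 1 / (2 * pi * x) * (2 * pi * (psi1 x / x - x / 2 * (1 - 1 / x)\<^sup>2))"
    using x by (simp add: field_simps power2_eq_square)
  then have "of_real (psi1 x / x\<^sup>2 - 1 / 2 * (1 - 1 / x)\<^sup>2) = (of_real (1 / (2 * pi * x)) :: complex) * ?R"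
    by (simp only: of_real_mult of_real_numeral)
  also have "\<dots> = 1 / (2 * of_real pi) * (LINT t|lborel. h_reg (Complex 1 t) * exp (\<i> * of_real t * of_real (ln x)))"
    unfolding eq[symmetric] using x by simp
  finally show ?thesis .
qed

text \<open>The shift $t \mapsto t + \pi/y$ changes the sign of $e^{ity}$.\<close>

lemma Riemann_Lebesgue_decay:
  fixes F :: "real \<Rightarrow> complex"
  assumes cont: "continuous_on UNIV F" and bound: "\<And>t. norm (F t) \<le> C * decay t"
  shows "((\<lambda>y. LINT t|lborel. F t * exp (\<i> * of_real t * of_real y)) \<longlongrightarrow> 0) at_top"
proof -
  have "0 \<le> C * decay 0" by (rule order_trans[OF norm_ge_zero bound])
  then have C0: "C \<ge> 0" using decay_pos[of 0] by (simp add: zero_le_mult_iff)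
  have F_int: "integrable lborel F" by (rule integrable_decay_bound[OF cont bound])
  have cont_shift: "continuous_on UNIV (\<lambda>t. F (t + u))" for u
    by (rule continuous_on_compose2[OF cont]) (auto intro!: continuous_intros)
  \<comment> \<open>For |u| <= 1 one has 1 + |t + u| >= (1 + |t|) / 2, which costs
    \<open>2 powr 1.5\<close>, rounded up to 4.\<close>
  have decay_shift: "decay (t + u) \<le> 4 * decay t" if "\<bar>u\<bar> \<le> 1" for t u
  proof -
    have "decay (t + u) \<le> ((1 + \<bar>t\<bar>) / 2) powr (- 1.5)"
    proof -
      have "\<bar>t\<bar> \<le> \<bar>t + u\<bar> + 1" using that by linarith
      moreover have "0 \<le> \<bar>t + u\<bar>" by (rule abs_ge_zero)
      ultimately have "(1 + \<bar>t\<bar>) / 2 \<le> 1 + \<bar>t + u\<bar>" by argo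
      then show ?thesis unfolding decay_def by (intro powr_mono2') auto
    qed
    also have "\<dots> = 2 powr 1.5 * decay t"
      by (simp add: decay_def powr_divide powr_minus field_simps)
    also have "\<dots> \<le> 2 powr 2 * decay t"
      using decay_pos[of t] by (intro mult_right_mono powr_mono) auto
    finally show ?thesis by simp
  qed
  \<comment> \<open>Continuity of translation in the L1 norm; the majorant 5C is C for
    \<open>F t\<close> plus 4C for the shifted value.\<close>
  have lim: "((\<lambda>y. LINT t|lborel. norm (F t - F (t + pi / y))) \<longlongrightarrow> (LINT t::real|lborel. (0::real))) at_top"
  proof (rule integral_dominated_convergence_at_top[where w = "\<lambda>t. 5 * C * decay t"])
    show "(\<lambda>t. norm (F t - F (t + pi / y))) \<in> borel_measurable lborel" for y
      using cont cont_shift[of "pi / y"] by (auto intro!: borel_measurable_continuous_onI continuous_intros)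
    show "integrable lborel (\<lambda>t. 5 * C * decay t)" using decay_integrable by simp
    show "AE t in lborel. ((\<lambda>y. norm (F t - F (t + pi / y))) \<longlongrightarrow> 0) at_top"
    proof (intro AE_I2)
      fix t
      have "((\<lambda>y. t + pi / y) \<longlongrightarrow> t) at_top" by real_asymp
      then have "((\<lambda>y. F (t + pi / y)) \<longlongrightarrow> F t) at_top"
        by (rule continuous_on_tendsto_compose[OF cont]) auto
      then have "((\<lambda>y. norm (F t - F (t + pi / y))) \<longlongrightarrow> norm (F t - F t)) at_top"
        by (intro tendsto_intros)
      then show "((\<lambda>y. norm (F t - F (t + pi / y))) \<longlongrightarrow> 0) at_top" by simp
    qed
    show "\<forall>\<^sub>F y in at_top. AE t in lborel. norm (norm (F t - F (t + pi / y))) \<le> 5 * C * decay t"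
      using eventually_ge_at_top[of pi]
    proof eventually_elim
      case (elim y)
      then have "y > 0" using pi_gt_zero by linarith
      with elim have "\<bar>pi / y\<bar> \<le> 1" by (simp add: divide_le_eq)
      show ?case
      proof (intro AE_I2)
        fix t
        have "norm (F t - F (t + pi / y)) \<le> norm (F t) + norm (F (t + pi / y))" by (rule norm_triangle_ineq4)
        also have "\<dots> \<le> C * decay t + C * (4 * decay t)"
          using bound[of t] order_trans[OF bound mult_left_mono[OF decay_shift[OF \<open>\<bar>pi / y\<bar> \<le> 1\<close>] C0]]
          by (intro add_mono)
        finally show "norm (norm (F t - F (t + pi / y))) \<le> 5 * C * decay t" by simp
      qed
    qed
  qed auto
  have "\<forall>\<^sub>F y in at_top. norm (LINT t|lborel. F t * exp (\<i> * of_real t * of_real y)) \<le>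
          (LINT t|lborel. norm (F t - F (t + pi / y)))"
    using eventually_gt_at_top[of 0]
  proof eventually_elim
    case (elim y)
    let ?e = "\<lambda>t. exp (\<i> * of_real t * of_real y)"
    let ?I = "LINT t|lborel. F t * ?e t"
    have e_norm: "norm (?e t) = 1" for t by simp
    have e_shift: "?e (pi / y + t) = - ?e t" for t
    proof -
      have "\<i> * of_real (pi / y + t) * of_real y = \<i> * of_real pi + \<i> * of_real t * of_real y"
        using elim by (simp add: field_simps)
      then show ?thesis by (simp only: exp_add exp_pi_i') simp
    qed
    have Fe_int: "integrable lborel (\<lambda>t. F (t + u) * ?e t)" if "integrable lborel (\<lambda>t. F (t + u))" for u
    proof (rule Bochner_Integration.integrable_bound[OF that])
      show "(\<lambda>t. F (t + u) * ?e t) \<in> borel_measurable lborel"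
        using cont_shift[of u] by (auto intro!: borel_measurable_continuous_onI continuous_intros)
    qed (simp add: norm_mult)
    have shift_int: "integrable lborel (\<lambda>t. F (t + u))" for u
      using lborel_integrable_real_affine[OF F_int, of 1 u] by (simp add: add.commute)
    have "?I = (LINT t|lborel. F (pi / y + 1 * t) * ?e (pi / y + 1 * t))"
      using lborel_integral_real_affine[of 1 "\<lambda>t. F t * ?e t" "pi / y"] by simp
    also have "\<dots> = - (LINT t|lborel. F (t + pi / y) * ?e t)"
      by (simp only: mult_1 e_shift) (simp add: add.commute)
    \<comment> \<open>Adding the shifted copy of opposite sign puts the difference of
      \<open>F\<close> and its translate under one integral.\<close>
    finally have "2 * ?I = ?I - (LINT t|lborel. F (t + pi / y) * ?e t)" by simp
    also have "\<dots> = (LINT t|lborel. F t * ?e t - F (t + pi / y) * ?e t)"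
      using Fe_int[of 0] Fe_int[of "pi / y"] shift_int F_int by (simp add: Bochner_Integration.integral_diff)
    also have "\<dots> = (LINT t|lborel. (F t - F (t + pi / y)) * ?e t)"
      by (simp add: left_diff_distrib)
    finally have "norm (2 * ?I) \<le> (LINT t|lborel. norm ((F t - F (t + pi / y)) * ?e t))"
      by (simp only: integral_norm_bound)
    then have "2 * norm ?I \<le> (LINT t|lborel. norm (F t - F (t + pi / y)))"
      unfolding norm_mult e_norm by simp
    then show ?case using norm_ge_zero[of ?I] by linarith
  qed
  then show ?thesis by (rule Lim_null_comparison) (use lim in simp)
qed

lemma psi1_div_square_tendsto: "((\<lambda>x. psi1 x / x\<^sup>2) \<longlongrightarrow> 1 / 2) at_top"
proof -
  obtain C where C: "\<And>c t. 1 \<le> c \<Longrightarrow> c \<le> 2 \<Longrightarrow> norm (h_reg (Complex c t)) \<le> C * decay t"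
    by (rule h_reg_decay) blast
  then have bound: "norm (h_reg (Complex 1 t)) \<le> C * decay t" for t by simp
  let ?J = "\<lambda>y. LINT t|lborel. h_reg (Complex 1 t) * exp (\<i> * of_real t * of_real y)"
  have "((\<lambda>x. 1 / (2 * of_real pi) * ?J (ln x)) \<longlongrightarrow> 1 / (2 * of_real pi) * 0) at_top"
    by (intro tendsto_intros filterlim_compose[OF Riemann_Lebesgue_decay[OF h_reg_line_continuous bound] ln_at_top]) auto
  moreover have "\<forall>\<^sub>F x in at_top. 1 / (2 * of_real pi) * ?J (ln x) = of_real (psi1 x / x\<^sup>2 - 1 / 2 * (1 - 1 / x)\<^sup>2)"
    using eventually_ge_at_top[of 1] by eventually_elim (rule psi1_formula[symmetric])
  ultimately have "((\<lambda>x. of_real (psi1 x / x\<^sup>2 - 1 / 2 * (1 - 1 / x)\<^sup>2) :: complex) \<longlongrightarrow> of_real 0) at_top"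
    using tendsto_cong by fastforce
  then have "((\<lambda>x. psi1 x / x\<^sup>2 - 1 / 2 * (1 - 1 / x)\<^sup>2) \<longlongrightarrow> 0) at_top"
    by (simp only: tendsto_of_real_iff)
  moreover have "((\<lambda>x::real. 1 / 2 * (1 - 1 / x)\<^sup>2) \<longlongrightarrow> 1 / 2) at_top" by real_asymp
  ultimately have "((\<lambda>x. psi1 x / x\<^sup>2 - 1 / 2 * (1 - 1 / x)\<^sup>2 + 1 / 2 * (1 - 1 / x)\<^sup>2) \<longlongrightarrow> 0 + 1 / 2) at_top"
    by (rule tendsto_add)
  then show ?thesis by simp
qed

section \<open>From psi1 to psi\<close>

lemma psi1_scaled_tendsto:
  assumes "k > 0"
  shows "((\<lambda>x. psi1 (k * x) / x\<^sup>2) \<longlongrightarrow> k\<^sup>2 / 2) at_top"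
proof -
  have "filterlim (\<lambda>x. k * x) at_top at_top"
    using assms by (intro filterlim_tendsto_pos_mult_at_top[OF tendsto_const] filterlim_ident)
  then have "((\<lambda>x. k\<^sup>2 * (psi1 (k * x) / (k * x)\<^sup>2)) \<longlongrightarrow> k\<^sup>2 * (1 / 2)) at_top"
    by (intro tendsto_intros filterlim_compose[OF psi1_div_square_tendsto])
  then show ?thesis using assms by (simp add: power_mult_distrib)
qed

text \<open>By monotonicity \<open>psi x\<close> is at least the mean of \<open>psi\<close> over the
  interval from kx to x with k < 1, and at most the mean from x to kx with k > 1. These means are
  asymptotic to (k + 1)/2 times x, and (k + 1)/2 lies strictly between k and 1, which leaves room
  for either strict inequality.\<close>

lemma psi_div_tendsto: "((\<lambda>x. psi x / x) \<longlongrightarrow> 1) at_top"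
proof -
  have lim: "((\<lambda>x. (psi1 (k * x) - psi1 x) / ((k - 1) * x\<^sup>2)) \<longlongrightarrow> (k + 1) / 2) at_top" if k: "k > 0" "k \<noteq> 1" for k
  proof -
    have "((\<lambda>x. (psi1 (k * x) / x\<^sup>2 - psi1 x / x\<^sup>2) / (k - 1)) \<longlongrightarrow> (k\<^sup>2 / 2 - 1 / 2) / (k - 1)) at_top"
      using k by (intro tendsto_intros psi1_scaled_tendsto psi1_div_square_tendsto) auto
    moreover have "(k\<^sup>2 / 2 - 1 / 2) / (k - 1) = (k + 1) / 2"
      using k by (simp add: field_simps power2_eq_square)
    moreover have "(psi1 (k * x) / x\<^sup>2 - psi1 x / x\<^sup>2) / (k - 1) = (psi1 (k * x) - psi1 x) / ((k - 1) * x\<^sup>2)" for x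
      by (simp add: diff_divide_distrib mult.commute)
    ultimately show ?thesis by (simp only:)
  qed
  show ?thesis
  proof (rule order_tendstoI)
    fix a :: real assume a: "a < 1"
    \<comment> \<open>The maximum keeps k positive when a <= 0, and k >= a gives (k + 1)/2 >
      a.\<close>
    define k where "k = max (1 / 2) a"
    have k: "0 < k" "k < 1" "a \<le> k" using a by (auto simp: k_def)
    have "\<forall>\<^sub>F x in at_top. a < (psi1 (k * x) - psi1 x) / ((k - 1) * x\<^sup>2)"
      by (rule order_tendstoD[OF lim]) (use k in auto)
    then show "\<forall>\<^sub>F x in at_top. a < psi x / x"
      using eventually_ge_at_top[of "1 / k"]
    proof eventually_elim
      case (elim x)
      have kx: "1 \<le> k * x" using elim(2) k by (simp add: field_simps)
      have x: "x > 0" using kx k by (smt (verit) zero_less_mult_iff)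
      have "psi1 x - psi1 (k * x) \<le> (x - k * x) * psi x"
        using kx k x by (intro psi1_diff_bounds) auto
      then have "(psi1 x - psi1 (k * x)) / ((1 - k) * x\<^sup>2) \<le> ((x - k * x) * psi x) / ((1 - k) * x\<^sup>2)"
        using k by (intro divide_right_mono) auto
      also have "\<dots> = psi x / x"
        using k x by (simp add: field_simps power2_eq_square)
      also have "(psi1 x - psi1 (k * x)) / ((1 - k) * x\<^sup>2) = (psi1 (k * x) - psi1 x) / ((k - 1) * x\<^sup>2)"
        using k x by (simp add: field_simps)
      finally show ?case using elim(1) by linarith
    qed
  next
    fix a :: real assume a: "a > 1"
    have "\<forall>\<^sub>F x in at_top. (psi1 (a * x) - psi1 x) / ((a - 1) * x\<^sup>2) < a"
      by (rule order_tendstoD[OF lim]) (use a in auto)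
    then show "\<forall>\<^sub>F x in at_top. psi x / x < a"
      using eventually_ge_at_top[of 1]
    proof eventually_elim
      case (elim x)
      have "(a * x - x) * psi x \<le> psi1 (a * x) - psi1 x"
        using elim a by (intro psi1_diff_bounds) auto
      then have "((a * x - x) * psi x) / ((a - 1) * x\<^sup>2) \<le> (psi1 (a * x) - psi1 x) / ((a - 1) * x\<^sup>2)"
        using a by (intro divide_right_mono) auto
      also have "((a * x - x) * psi x) / ((a - 1) * x\<^sup>2) = psi x / x"
        using a elim by (simp add: field_simps power2_eq_square)
      finally show ?case using elim(1) by linarith
    qed
  qed
qed

theorem theorem7p3:
  "integrable lborel (\<lambda>t::real. cmod (h (1 + \<i> * of_real t))) \<and>
   (\<forall>x::real. x \<ge> 1 \<longrightarrow>
      complex_of_real (psi1 x / x\<^sup>2 - 1 / 2 * (1 - 1 / x)\<^sup>2) =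
      1 / (2 * of_real pi) *
        (LINT t|lborel. h (1 + \<i> * of_real t) * exp (\<i> * of_real t * of_real (ln x)))) \<and>
   psi1 \<sim>[at_top] (\<lambda>x. x\<^sup>2 / 2) \<and>
   psi \<sim>[at_top] (\<lambda>x. x)"
proof -
  have h: "h (1 + \<i> * of_real t) = h_reg (Complex 1 t)" for t
    using h_eq_h_reg[of "Complex 1 t"] by (simp add: Complex_eq)
  have "((\<lambda>x. psi1 x / (x\<^sup>2 / 2)) \<longlongrightarrow> 1) at_top"
    using tendsto_mult[OF tendsto_const[of 2] psi1_div_square_tendsto] by (simp add: mult.commute)
  then show ?thesis
    unfolding h using psi1_formula integrable_norm[OF h_reg_line_integrable] psi_div_tendsto
    by (auto intro: asymp_equivI')
qed

end
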